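(* For any divisorial valuation $\nu$ of $\mathbb{P}^2$ it holds that $$\hat{\mu}(\nu)\leq \overline{\beta}_0(\nu)+\left(1+\delta_0(\nu)\right)t(\nu).$$
   Context: Let $\Bbbk$ be an algebraically closed field of arbitrary characteristic and $\mathbb{P}^2$ the projective plane over $\Bbbk$. A divisorial valuation $\nu$ of $\mathbb{P}^2$ centered at a closed point $p$ is the valuation of the function field of $\mathbb{P}^2$ given by the order of vanishing along the last exceptional divisor $E_n$ ($n\ge 1$) of a finite simple sequence of point blowups $X_\nu=X_n\xrightarrow{\pi_n}X_{n-1}\to\cdots\to X_1\xrightarrow{\pi_1}X_0=\mathbb{P}^2$, where $\pi_i$ is the blowup at a closed point $p_i\in X_{i-1}$ with exceptional divisor $E_i$, $p_1=p$, and $p_{i+1}\in E_i$ for $1\le i\le n-1$. Let $\mathfrak{m}$ be the maximal ideal of $\mathcal{O}_{\mathbb{P}^2,p}$; $\nu$ is the $\mathfrak{m}$-adic valuation exactly when $n=1$. Set $\overline{\beta}_0(\nu):=\nu(\mathfrak{m})=\min\{\nu(x)\mid x\in\mathfrak{m}\setminus\{0\}\}$. The volume is $\mathrm{vol}(\nu):=\limsup_{m\to\infty}\frac{2\,\mathrm{length}(\mathcal{O}_{\mathbb{P}^2,p}/\mathcal{P}_m)}{m^2}$, where $\mathcal{P}_m=\{h\in\mathcal{O}_{\mathbb{P}^2,p}\mid \nu(h)\ge m\}\cup\{0\}$ (it is known that $\mathrm{vol}(\nu)^{-1}=\sum_{i=1}^n v_i^2$, $v_i$ being the value under $\nu$ of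 the maximal ideal of $\mathcal{O}_{X_{i-1},p_i}$). For a curve $S$ of $\mathbb{P}^2$, $\varphi_S\in\mathcal{O}_{\mathbb{P}^2,p}$ denotes a local equation of $S$ at $p$. If $\nu$ is not the $\mathfrak{m}$-adic valuation, there is a unique line $H$ of $\mathbb{P}^2$ (the tangent line of $\nu$) with $\nu(\varphi_H)>\overline{\beta}_0(\nu)$; put $t(\nu):=\nu(\varphi_H)$. If $\nu$ is $\mathfrak{m}$-adic, $t(\nu):=1$. Put $\delta_0(\nu):=-1$ if $\nu$ is the $\mathfrak{m}$-adic valuation and, otherwise, $\delta_0(\nu):=\left\lceil\frac{\mathrm{vol}(\nu)^{-1}-2\overline{\beta}_0(\nu)t(\nu)}{t(\nu)^2}\right\rceil^+$, where $\lceil x\rceil^+$ is the ceiling of the rational number $x$ if $x\ge 0$, and $0$ otherwise. Seshadri-type constant. Take homogeneous coordinates $(X:Y:Z)$ with $p=(1:0:0)$ and affine coordinates $u=Y/X$, $v=Z/X$ around $p$, so that $\nu$ is a valuation of $\Bbbk(u,v)$ centered at $\Bbbk[u,v]_{(u,v)}$. For each positive integer $d$ let $\mu_d(\nu):=\max\{\nu(h)\mid 0\neq h\in\Bbbk[u,v],\ \deg(h)\le d\}$. Then $\hat{\mu}(\nu):=\lim_{d\to\infty}\frac{\mu_d(\nu)}{d}$. *)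

theory Defs
  imports
    "HOL-Analysis.Analysis"
    "HOL-Computational_Algebra.Computational_Algebra"
begin

text \<open>
  Fix reference coordinates \<open>(W1 : W2 : W3)\<close> on the projective plane over \<open>'a\<close>. Its function
  field is the field of rational functions in \<open>W2 / W1\<close> and \<open>W3 / W1\<close>. A bivariate polynomial is
  a term of type \<open>'a poly poly\<close>, and \<open>coeff (coeff h j) i\<close> is the coefficient of the monomial
  (first variable)\<open>^i\<close> (second variable)\<open>^j\<close>.
\<close>

type_synonym 'a plane_function_field = "'a poly poly fract"

definition const_fun :: "'a::field \<Rightarrow> 'a plane_function_field" where
  "const_fun c = to_fract [:[:c:]:]"

definition eval2 ::
  "'a::field poly poly \<Rightarrow> 'a plane_function_field \<Rightarrow> 'a plane_function_field \<Rightarrow> 'a plane_function_field"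
  where "eval2 h x y = poly (map_poly (\<lambda>q. poly (map_poly const_fun q) x) h) y"

definition total_degree_le :: "'a::field poly poly \<Rightarrow> nat \<Rightarrow> bool" where
  "total_degree_le h d \<longleftrightarrow> (\<forall>i j. coeff (coeff h j) i \<noteq> 0 \<longrightarrow> i + j \<le> d)"

text \<open>The linear form with coefficient vector \<open>l\<close>, divided by \<open>W1\<close>.\<close>

definition linear_form :: "'a::field ^ 3 \<Rightarrow> 'a plane_function_field" where
  "linear_form l =
     const_fun (l $ 1) + const_fun (l $ 2) * to_fract [:[:0, 1:]:] + const_fun (l $ 3) * to_fract [:0, 1:]"

text \<open>
  \<open>p\<close> is a vector of homogeneous coordinates of a closed point. The rows of \<open>A\<close> are the linear
  forms \<open>X, Y, Z\<close> of a homogeneous coordinate system in which the point is \<open>(1 : 0 : 0)\<close>, and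
  \<open>u = Y / X\<close>, \<open>v = Z / X\<close>. (Requiring \<open>A *v p\<close> to be exactly \<open>(1, 0, 0)\<close> costs nothing, since
  rescaling \<open>A\<close> does not change \<open>u\<close> and \<open>v\<close>.)
\<close>

definition affine_coordinates_at ::
  "'a::field ^ 3 \<Rightarrow> 'a plane_function_field \<Rightarrow> 'a plane_function_field \<Rightarrow> bool" where
  "affine_coordinates_at p u v \<longleftrightarrow>
     (\<exists>A :: 'a ^ 3 ^ 3. invertible A \<and> A *v p = vector [1, 0, 0] \<and>
        u = linear_form (A $ 2) / linear_form (A $ 1) \<and>
        v = linear_form (A $ 3) / linear_form (A $ 1))"

text \<open>
  The local ring at a closed point with local coordinates \<open>x, y\<close>, i.e. the localization of
  \<open>k[x, y]\<close> at the ideal \<open>(x, y)\<close>, as a subring of the function field, and its maximal ideal.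
\<close>

definition local_ring ::
  "'a::field plane_function_field \<Rightarrow> 'a plane_function_field \<Rightarrow> 'a plane_function_field set" where
  "local_ring x y = {eval2 f x y / eval2 g x y | f g. coeff (coeff g 0) 0 \<noteq> 0}"

definition max_ideal ::
  "'a::field plane_function_field \<Rightarrow> 'a plane_function_field \<Rightarrow> 'a plane_function_field set" where
  "max_ideal x y =
     {eval2 f x y / eval2 g x y | f g. coeff (coeff f 0) 0 = 0 \<and> coeff (coeff g 0) 0 \<noteq> 0}"

definition is_ideal :: "'b::comm_ring_1 set \<Rightarrow> 'b set \<Rightarrow> bool" where
  "is_ideal R I \<longleftrightarrow>
     I \<subseteq> R \<and> 0 \<in> I \<and> (\<forall>a\<in>I. \<forall>b\<in>I. a + b \<in> I) \<and> (\<forall>r\<in>R. \<forall>a\<in>I. r * a \<in> I)"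

definition ideal_generated :: "'b::comm_ring_1 set \<Rightarrow> 'b set \<Rightarrow> 'b set" where
  "ideal_generated R S = \<Inter> {I. is_ideal R I \<and> S \<subseteq> I}"

primrec max_ideal_power ::
  "'a::field plane_function_field \<Rightarrow> 'a plane_function_field \<Rightarrow> nat \<Rightarrow> 'a plane_function_field set"
  where
    "max_ideal_power x y 0 = local_ring x y"
  | "max_ideal_power x y (Suc k) =
       ideal_generated (local_ring x y) {a * b | a b. a \<in> max_ideal x y \<and> b \<in> max_ideal_power x y k}"

text \<open>
  The length of the \<open>R\<close>-module \<open>R / I\<close>: the supremum of the lengths of strict chains of
  submodules, which correspond to the ideals of \<open>R\<close> containing \<open>I\<close>.
\<close>

definition quotient_length :: "'b::comm_ring_1 set \<Rightarrow> 'b set \<Rightarrow> enat" where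
  "quotient_length R I =
     Sup {enat n | n. \<exists>J :: nat \<Rightarrow> 'b set.
            (\<forall>i\<le>n. is_ideal R (J i) \<and> I \<subseteq> J i) \<and> (\<forall>i<n. J i \<subset> J (Suc i))}"

text \<open>
  \<open>blowup_coordinates u v x y\<close> states that \<open>x, y\<close> are local coordinates at the last point \<open>p\<^sub>i\<close> of
  a simple sequence of points \<open>p\<^sub>1, \<dots>, p\<^sub>i\<close>, where \<open>p\<^sub>1\<close> has coordinates \<open>u, v\<close> and each \<open>p\<^sub>j\<^sub>+\<^sub>1\<close> is
  a closed point of the exceptional divisor \<open>E\<^sub>j\<close> of the blowup at \<open>p\<^sub>j\<close>.
  The blowup at the point \<open>x = y = 0\<close> is covered by the two charts with coordinates \<open>(x, y / x)\<close>
  and \<open>(x / y, y)\<close>. In the first chart the exceptional divisor is \<open>x = 0\<close> and its closed points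
  are \<open>(0, c)\<close> (the ground field is algebraically closed); the only closed point of the
  exceptional divisor outside the first chart is the origin of the second one.
\<close>

inductive blowup_coordinates ::
  "'a::field plane_function_field \<Rightarrow> 'a plane_function_field \<Rightarrow>
   'a plane_function_field \<Rightarrow> 'a plane_function_field \<Rightarrow> bool"
  for u v where
    base: "blowup_coordinates u v u v"
  | finite_point: "blowup_coordinates u v x y \<Longrightarrow> blowup_coordinates u v x (y / x - const_fun c)"
  | infinite_point: "blowup_coordinates u v x y \<Longrightarrow> blowup_coordinates u v (x / y) y"

text \<open>
  The order of vanishing along the exceptional divisor \<open>E\<close> of the blowup at the point with local
  coordinates \<open>x, y\<close>. In the chart with coordinates \<open>(x, w)\<close>, \<open>w = y / x\<close>, the divisor \<open>E\<close> is
  \<open>x = 0\<close>, the local ring at its generic point is \<open>k[x, w]\<close> localized at the prime \<open>(x)\<close>, and \<open>x\<close>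
  is a uniformizer. The condition \<open>map_poly (\<lambda>q. coeff q 0) a \<noteq> 0\<close> says that the restriction of
  \<open>a\<close> to \<open>x = 0\<close> is nonzero, i.e. that the first variable does not divide \<open>a\<close>.
  Only nonzero \<open>f\<close> are relevant.
\<close>

definition exceptional_order ::
  "'a::field plane_function_field \<Rightarrow> 'a plane_function_field \<Rightarrow> 'a plane_function_field \<Rightarrow> int" where
  "exceptional_order x y f =
     (THE k. \<exists>a b. map_poly (\<lambda>q. coeff q 0) a \<noteq> 0 \<and> map_poly (\<lambda>q. coeff q 0) b \<noteq> 0 \<and>
        f = (x powi k) * (eval2 a x (y / x) / eval2 b x (y / x)))"

text \<open>The value of a valuation at \<open>0\<close> is irrelevant and left unconstrained.\<close>

definition divisorial_valuation ::
  "'a::field plane_function_field \<Rightarrow> 'a plane_function_field \<Rightarrow>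
   ('a plane_function_field \<Rightarrow> int) \<Rightarrow> bool" where
  "divisorial_valuation u v \<nu> \<longleftrightarrow>
     (\<exists>x y. blowup_coordinates u v x y \<and> (\<forall>f. f \<noteq> 0 \<longrightarrow> \<nu> f = exceptional_order x y f))"

definition madic ::
  "'a::field plane_function_field \<Rightarrow> 'a plane_function_field \<Rightarrow>
   ('a plane_function_field \<Rightarrow> int) \<Rightarrow> bool" where
  "madic u v \<nu> \<longleftrightarrow>
     (\<forall>f \<in> local_ring u v - {0}. \<forall>k. f \<in> max_ideal_power u v k \<longleftrightarrow> int k \<le> \<nu> f)"

definition beta0 ::
  "'a::field plane_function_field \<Rightarrow> 'a plane_function_field \<Rightarrow>
   ('a plane_function_field \<Rightarrow> int) \<Rightarrow> int" where
  "beta0 u v \<nu> = (LEAST k. \<exists>f \<in> max_ideal u v - {0}. \<nu> f = k)"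

definition valuation_ideal ::
  "'a::field plane_function_field \<Rightarrow> 'a plane_function_field \<Rightarrow>
   ('a plane_function_field \<Rightarrow> int) \<Rightarrow> nat \<Rightarrow> 'a plane_function_field set" where
  "valuation_ideal u v \<nu> m = {h \<in> local_ring u v. h \<noteq> 0 \<and> int m \<le> \<nu> h} \<union> {0}"

definition vol ::
  "'a::field plane_function_field \<Rightarrow> 'a plane_function_field \<Rightarrow>
   ('a plane_function_field \<Rightarrow> int) \<Rightarrow> real" where
  "vol u v \<nu> =
     real_of_ereal
       (limsup (\<lambda>m. 2 * ereal_of_enat (quotient_length (local_ring u v) (valuation_ideal u v \<nu> m))
                      / ereal (real m ^ 2)))"

text \<open>
  A local equation at \<open>p\<close> of the line \<open>l\<^sub>1 X + l\<^sub>2 Y + l\<^sub>3 Z = 0\<close> (a unit if the line does not pass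
  through \<open>p\<close>).
\<close>

definition line_equation ::
  "'a::field plane_function_field \<Rightarrow> 'a plane_function_field \<Rightarrow> 'a ^ 3 \<Rightarrow> 'a plane_function_field"
  where "line_equation u v l = const_fun (l $ 1) + const_fun (l $ 2) * u + const_fun (l $ 3) * v"

text \<open>
  The tangent line is unique, its coefficient vector is unique up to a nonzero scalar. Hence the
  value below is well defined.
\<close>

definition tangent_value ::
  "'a::field plane_function_field \<Rightarrow> 'a plane_function_field \<Rightarrow>
   ('a plane_function_field \<Rightarrow> int) \<Rightarrow> int" where
  "tangent_value u v \<nu> =
     (if madic u v \<nu> then 1
      else THE t. \<exists>l. l \<noteq> 0 \<and> \<nu> (line_equation u v l) > beta0 u v \<nu> \<and> t = \<nu> (line_equation u v l))"

definition ceiling_plus :: "real \<Rightarrow> int" where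
  "ceiling_plus x = (if x \<ge> 0 then \<lceil>x\<rceil> else 0)"

definition delta0 ::
  "'a::field plane_function_field \<Rightarrow> 'a plane_function_field \<Rightarrow>
   ('a plane_function_field \<Rightarrow> int) \<Rightarrow> int" where
  "delta0 u v \<nu> =
     (if madic u v \<nu> then -1
      else ceiling_plus
        ((inverse (vol u v \<nu>) - 2 * real_of_int (beta0 u v \<nu>) * real_of_int (tangent_value u v \<nu>))
           / real_of_int (tangent_value u v \<nu>) ^ 2))"

definition mu ::
  "'a::field plane_function_field \<Rightarrow> 'a plane_function_field \<Rightarrow>
   ('a plane_function_field \<Rightarrow> int) \<Rightarrow> nat \<Rightarrow> int" where
  "mu u v \<nu> d =
     (GREATEST k. \<exists>h :: 'a poly poly. h \<noteq> 0 \<and> total_degree_le h d \<and> \<nu> (eval2 h u v) = k)"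

definition mu_hat ::
  "'a::field plane_function_field \<Rightarrow> 'a plane_function_field \<Rightarrow>
   ('a plane_function_field \<Rightarrow> int) \<Rightarrow> real" where
  "mu_hat u v \<nu> = lim (\<lambda>d. real_of_int (mu u v \<nu> d) / real d)"

end

theory Submission
  imports Defs "HOL-Library.Nat_Bijection" "HOL-Real_Asymp.Real_Asymp"
begin

text \<open>
  No surface geometry is needed: the bound follows from a local intersection inequality. Let \<open>f\<close> be
  a polynomial of degree \<open>\<le> d\<close> not divisible by the tangent line \<open>l\<close>. Restricting \<open>f\<close> to the line
  shows that the ideal \<open>(f, l)\<close> of the local ring \<open>\<O>\<close> has colength \<open>k \<le> d\<close>. Since the valuation
  ideal \<open>P\<^sub>m\<close> contains all \<open>f\<^sup>a l\<^sup>b\<close> with \<open>a \<nu>(f) + b \<nu>(l) \<ge> m\<close>, the length of \<open>\<O> / P\<^sub>m\<close> is at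
  most \<open>k\<close> times the number of lattice points with \<open>a \<nu>(f) + b \<nu>(l) < m\<close>. Hence
  \<open>vol(\<nu>) \<nu>(f) \<nu>(l) \<le> k \<le> d\<close>, and with \<open>t = \<nu>(l) > \<beta>\<^sub>0\<close> the definition of \<open>\<delta>\<^sub>0\<close> gives
  \<open>\<nu>(f) / d \<le> 1 / (vol(\<nu>) t) \<le> \<beta>\<^sub>0 + (1 + \<delta>\<^sub>0) t\<close>. Factors \<open>l\<close> of \<open>f\<close> contribute \<open>t\<close> per degree.

  That \<open>vol(\<nu>)\<close> is positive is a linear Izumi-type estimate: a blowup at most doubles the order of
  vanishing of a function at the centre, so \<open>\<nu> \<le> 2\<^sup>N ord\<close>.
\<close>

section \<open>Bivariate polynomials and coordinates\<close>

text \<open>Geometry is turned into statements about supports of bivariate polynomials. This works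
  because every pair of coordinates at an infinitely near point is again algebraically independent
  and generates the function field, so each function is a quotient of two polynomials whose
  coefficients can be inspected. What has to be known about a valuation is collected in the locale
  \<open>plane_valuation\<close>, which mentions only coordinates at a centre; the same divisorial
  valuation is therefore available at \<open>p\<close> and also at the second point of the blowup
  sequence, and this yields the tangent line. The definitions by \<open>THE\<close>,
  \<open>LEAST\<close>, \<open>GREATEST\<close>, \<open>lim\<close> and \<open>real_of_ereal\<close>
  shape the rest: a bound on them has content only once uniqueness, attained extrema, convergence
  and a finite volume are known. Positivity of the volume matters for a further reason: values are
  bounded by multiples of \<open>inverse (vol u v \<nu>)\<close>, and the inverse of 0 is 0.\<close>

locale comm_ring_map =
  fixes \<phi> :: "'b::comm_ring_1 \<Rightarrow> 'c::comm_ring_1"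
  assumes map_one: "\<phi> 1 = 1"
    and map_add: "\<phi> (a + b) = \<phi> a + \<phi> b"
    and map_mult: "\<phi> (a * b) = \<phi> a * \<phi> b"
begin

lemma map_zero: "\<phi> 0 = 0"
  using map_add[of 0 0] by simp

lemma map_uminus: "\<phi> (- a) = - \<phi> a"
  using map_add[of a "- a"] map_zero by (simp add: eq_neg_iff_add_eq_0 add.commute)

lemma map_diff: "\<phi> (a - b) = \<phi> a - \<phi> b"
  using map_add[of a "- b"] map_uminus by simp

lemma map_power: "\<phi> (a ^ n) = \<phi> a ^ n"
  by (induction n) (simp_all add: map_one map_mult)

lemma map_sum: "\<phi> (sum f A) = (\<Sum>i\<in>A. \<phi> (f i))"
  by (induction A rule: infinite_finite_induct) (simp_all add: map_zero map_add)

lemma poly_map_pCons: "poly (map_poly \<phi> (pCons a q)) x = \<phi> a + x * poly (map_poly \<phi> q) x"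
  by (simp add: map_poly_pCons map_zero)

lemma poly_map_add:
  "poly (map_poly \<phi> (p + q)) x = poly (map_poly \<phi> p) x + poly (map_poly \<phi> q) x"
  by (induction p q rule: poly_induct2) (simp_all add: poly_map_pCons map_add algebra_simps)

lemma poly_map_smult: "poly (map_poly \<phi> (smult a p)) x = \<phi> a * poly (map_poly \<phi> p) x"
  by (induction p) (simp_all add: poly_map_pCons map_mult algebra_simps)

lemma poly_map_mult:
  "poly (map_poly \<phi> (p * q)) x = poly (map_poly \<phi> p) x * poly (map_poly \<phi> q) x"
  by (induction p)
    (simp_all add: poly_map_pCons poly_map_add poly_map_smult map_zero algebra_simps)

lemma poly_map_comm_ring_map: "comm_ring_map (\<lambda>q. poly (map_poly \<phi> q) x)"
  by unfold_locales (simp_all add: poly_map_add poly_map_mult map_one)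

end

lemma const_fun_ring_map: "comm_ring_map const_fun"
proof
  show "const_fun 1 = (1 :: 'a plane_function_field)"
    by (simp add: const_fun_def one_pCons[symmetric])
  show "const_fun (a + b) = const_fun a + const_fun b" for a b :: 'a
    by (simp add: const_fun_def to_fract_add[symmetric] del: to_fract_add)
  show "const_fun (a * b) = const_fun a * const_fun b" for a b :: 'a
    by (simp add: const_fun_def to_fract_mult[symmetric] mult.commute del: to_fract_mult)
qed

interpretation const_fun: comm_ring_map const_fun
  by (rule const_fun_ring_map)

lemma const_fun_eq_0_iff [simp]: "const_fun c = 0 \<longleftrightarrow> c = 0"
  by (simp add: const_fun_def)

lemma eval2_ring_map: "comm_ring_map (\<lambda>h. eval2 h x y)"
  unfolding eval2_def
  by (intro comm_ring_map.poly_map_comm_ring_map const_fun_ring_map)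

interpretation eval2: comm_ring_map "\<lambda>h. eval2 h x y" for x y
  by (rule eval2_ring_map)

lemma eval2_monom: "eval2 (monom (monom c i) j) x y = const_fun c * x ^ i * y ^ j"
  by (simp add: eval2_def map_poly_monom poly_monom const_fun.map_zero)

lemma eval2_const [simp]: "eval2 [:[:c:]:] x y = const_fun c"
  by (simp add: eval2_def map_poly_pCons const_fun.map_zero)

lemma eval2_X [simp]: "eval2 [:[:0, 1:]:] x y = x"
  by (simp add: eval2_def map_poly_pCons const_fun.map_zero const_fun.map_one)

lemma eval2_Y [simp]: "eval2 [:0, 1:] x y = y"
  by (simp add: eval2_def map_poly_pCons const_fun.map_zero const_fun.map_one)

section \<open>Coefficients, supports and monomial substitutions\<close>

definition coeff2 :: "'a::field poly poly \<Rightarrow> nat \<times> nat \<Rightarrow> 'a" where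
  "coeff2 h p = coeff (coeff h (snd p)) (fst p)"

lemma coeff2_pair: "coeff2 h (i, j) = coeff (coeff h j) i"
  by (simp add: coeff2_def)

lemma coeff2_eqI: "(\<And>p. coeff2 h p = coeff2 g p) \<Longrightarrow> h = g"
  by (intro poly_eqI) (metis coeff2_pair)

lemma coeff2_0 [simp]: "coeff2 0 p = 0"
  by (simp add: coeff2_def)

lemma coeff2_add [simp]: "coeff2 (f + g) p = coeff2 f p + coeff2 g p"
  by (simp add: coeff2_def)

lemma coeff2_sum: "coeff2 (sum f A) p = (\<Sum>i\<in>A. coeff2 (f i) p)"
  by (simp add: coeff2_def coeff_sum)

lemma coeff2_monom: "coeff2 (monom (monom c i) j) p = (if p = (i, j) then c else 0)"
  by (cases p) (auto simp: coeff2_def)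

lemma coeff2_mult:
  "coeff2 (f * g) (i, j) = (\<Sum>j'\<le>j. \<Sum>i'\<le>i. coeff2 f (i', j') * coeff2 g (i - i', j - j'))"
  by (simp add: coeff2_def coeff_mult coeff_sum)

lemma coeff2_mult_00 [simp]: "coeff2 (f * g) (0, 0) = coeff2 f (0, 0) * coeff2 g (0, 0)"
  by (simp add: coeff2_mult)

lemma coeff2_nonzero: "h \<noteq> 0 \<Longrightarrow> \<exists>p. coeff2 h p \<noteq> 0"
  using coeff2_eqI[of h 0] by auto

definition supp2 :: "'a::field poly poly \<Rightarrow> (nat \<times> nat) set" where
  "supp2 h = {p. coeff2 h p \<noteq> 0}"

lemma mem_supp2 [simp]: "p \<in> supp2 h \<longleftrightarrow> coeff2 h p \<noteq> 0"
  by (simp add: supp2_def)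

lemma finite_supp2 [simp]: "finite (supp2 h)"
proof (rule finite_subset)
  show "supp2 h \<subseteq> (\<Union>j\<le>degree h. (\<lambda>i. (i, j)) ` {..degree (coeff h j)})"
  proof
    fix p assume "p \<in> supp2 h"
    then have *: "coeff (coeff h (snd p)) (fst p) \<noteq> 0"
      by (simp add: coeff2_def)
    then have "coeff h (snd p) \<noteq> 0" by auto
    then have "snd p \<le> degree h" by (rule le_degree)
    moreover have "fst p \<le> degree (coeff h (snd p))" using * by (rule le_degree)
    ultimately show "p \<in> (\<Union>j\<le>degree h. (\<lambda>i. (i, j)) ` {..degree (coeff h j)})"
      by (cases p) auto
  qed
qed simp

text \<open>Both charts of a blowup, and clearing their denominators, act on a polynomial by a map
  of exponents. If that map is injective on the support, monomials cannot cancel.\<close>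

definition reindex :: "(nat \<times> nat \<Rightarrow> nat \<times> nat) \<Rightarrow> 'a::field poly poly \<Rightarrow> 'a poly poly" where
  "reindex e h = (\<Sum>p\<in>supp2 h. monom (monom (coeff2 h p) (fst (e p))) (snd (e p)))"

lemma reindex_id: "reindex (\<lambda>p. p) h = h"
proof (rule coeff2_eqI)
  fix p
  show "coeff2 (reindex (\<lambda>p. p) h) p = coeff2 h p"
    by (simp add: reindex_def coeff2_sum coeff2_monom sum.delta')
qed

lemma coeff2_reindex:
  assumes "inj_on e (supp2 h)" "coeff2 h p \<noteq> 0"
  shows "coeff2 (reindex e h) (e p) = coeff2 h p"
proof -
  have "coeff2 (reindex e h) (e p) = (\<Sum>q\<in>supp2 h. if q = p then coeff2 h q else 0)"
    unfolding reindex_def coeff2_sum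
    using assms by (intro sum.cong) (auto simp: coeff2_monom prod_eq_iff[symmetric] dest: inj_onD)
  then show ?thesis using assms(2) by (simp add: sum.delta')
qed

lemma coeff2_reindex_outside:
  assumes "\<And>p. coeff2 h p \<noteq> 0 \<Longrightarrow> e p \<noteq> q"
  shows "coeff2 (reindex e h) q = 0"
  unfolding reindex_def coeff2_sum
  by (rule sum.neutral) (use assms in \<open>force simp: coeff2_monom\<close>)

lemma eval2_reindex:
  "eval2 (reindex e h) x y = (\<Sum>p\<in>supp2 h. const_fun (coeff2 h p) * x ^ fst (e p) * y ^ snd (e p))"
  by (simp add: reindex_def eval2.map_sum eval2_monom)

lemma eval2_supp2: "eval2 h x y = (\<Sum>p\<in>supp2 h. const_fun (coeff2 h p) * x ^ fst p * y ^ snd p)"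
  using eval2_reindex[of "\<lambda>p. p" h x y] by (simp add: reindex_id)

lemma reindex_nonzero:
  assumes "inj_on e (supp2 h)" "h \<noteq> 0"
  shows "reindex e h \<noteq> 0"
  using coeff2_reindex[OF assms(1)] coeff2_nonzero[OF assms(2)] by fastforce

section \<open>Independent generators of the function field\<close>

definition alg_indep :: "'a::field plane_function_field \<Rightarrow> 'a plane_function_field \<Rightarrow> bool" where
  "alg_indep x y \<longleftrightarrow> (\<forall>h. eval2 h x y = 0 \<longrightarrow> h = 0)"

lemma alg_indepD: "alg_indep x y \<Longrightarrow> eval2 h x y = 0 \<longleftrightarrow> h = 0"
  by (auto simp: alg_indep_def eval2.map_zero)

lemma alg_indep_nonzero:
  assumes "alg_indep x y"
  shows "x \<noteq> 0" "y \<noteq> 0"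
  using alg_indepD[OF assms, of "[:[:0, 1:]:]"] alg_indepD[OF assms, of "[:0, 1:]"] by auto

lemma alg_indep_cancel:
  assumes "alg_indep x y" "eval2 g x y = eval2 h x y"
  shows "g = h"
  using alg_indepD[OF assms(1), of "g - h"] assms(2) by (simp add: eval2.map_diff)

definition subfield :: "'b::field set \<Rightarrow> bool" where
  "subfield S \<longleftrightarrow> (\<forall>a\<in>S. \<forall>b\<in>S. a + b \<in> S \<and> a * b \<in> S) \<and> (\<forall>a\<in>S. - a \<in> S \<and> inverse a \<in> S)"

text \<open>Phrased through subfields rather than fractions because a change of coordinates is then
  immediate: a subfield containing the new pair contains the old one.\<close>

definition field_gens :: "'a::field plane_function_field \<Rightarrow> 'a plane_function_field \<Rightarrow> bool" where
  "field_gens x y \<longleftrightarrow> (\<forall>S. subfield S \<and> range const_fun \<subseteq> S \<and> x \<in> S \<and> y \<in> S \<longrightarrow> S = UNIV)"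

lemma subfield_closed:
  assumes "subfield S"
  shows "a \<in> S \<Longrightarrow> b \<in> S \<Longrightarrow> a + b \<in> S" "a \<in> S \<Longrightarrow> b \<in> S \<Longrightarrow> a * b \<in> S"
    "a \<in> S \<Longrightarrow> b \<in> S \<Longrightarrow> a - b \<in> S" "a \<in> S \<Longrightarrow> b \<in> S \<Longrightarrow> a / b \<in> S"
proof -
  show "a \<in> S \<Longrightarrow> b \<in> S \<Longrightarrow> a + b \<in> S" "a \<in> S \<Longrightarrow> b \<in> S \<Longrightarrow> a * b \<in> S"
    using assms by (auto simp: subfield_def)
  show "a - b \<in> S" if "a \<in> S" "b \<in> S"
    using that assms unfolding subfield_def by (metis add_uminus_conv_diff)
  show "a / b \<in> S" if "a \<in> S" "b \<in> S"
    using that assms unfolding subfield_def divide_inverse by metis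
qed

lemma subfield_eval2:
  assumes "subfield S" "range const_fun \<subseteq> S" "x \<in> S" "y \<in> S"
  shows "eval2 h x y \<in> S"
proof -
  have pow: "z ^ n \<in> S" if "z \<in> S" for z n
  proof (induction n)
    case 0
    have "const_fun 1 \<in> S" using assms(2) by blast
    then show ?case by (simp add: const_fun.map_one)
  next
    case (Suc n)
    then show ?case using that subfield_closed[OF assms(1)] by simp
  qed
  have sum: "sum g A \<in> S" if "\<And>p. p \<in> A \<Longrightarrow> g p \<in> S" for g and A :: "(nat \<times> nat) set"
    using that
  proof (induction A rule: infinite_finite_induct)
    have "const_fun 0 \<in> S" using assms(2) by blast
    moreover case (infinite A)
    ultimately show ?case by (simp add: const_fun.map_zero)
  next
    have "const_fun 0 \<in> S" using assms(2) by blast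
    moreover case empty
    ultimately show ?case by (simp add: const_fun.map_zero)
  next
    case (insert p A)
    then show ?case using subfield_closed[OF assms(1)] by simp
  qed
  have "const_fun c * x ^ i * y ^ j \<in> S" for c i j
  proof -
    have "const_fun c \<in> S" using assms(2) by blast
    then show ?thesis using pow[OF assms(3)] pow[OF assms(4)] subfield_closed[OF assms(1)] by simp
  qed
  then show ?thesis unfolding eval2_supp2 by (intro sum)
qed

lemma field_gens_fraction:
  assumes "field_gens x y" "alg_indep x y"
  shows "\<exists>a b. b \<noteq> 0 \<and> f = eval2 a x y / eval2 b x y"
proof -
  define S where "S = {eval2 a x y / eval2 b x y | a b. b \<noteq> 0}"
  have SI: "eval2 a x y / eval2 b x y \<in> S" if "b \<noteq> 0" for a b
    using that unfolding S_def by blast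
  have nz: "eval2 b x y \<noteq> 0" if "b \<noteq> 0" for b
    using that alg_indepD[OF assms(2)] by simp
  have "subfield S"
    unfolding subfield_def
  proof (intro conjI ballI)
    fix f g assume "f \<in> S" "g \<in> S"
    then obtain a b c d where *: "b \<noteq> 0" "d \<noteq> 0" "f = eval2 a x y / eval2 b x y" "g = eval2 c x y / eval2 d x y"
      unfolding S_def by blast
    have "f + g = eval2 (a * d + c * b) x y / eval2 (b * d) x y"
      using * nz by (simp add: eval2.map_add eval2.map_mult add_frac_eq mult.commute)
    then show "f + g \<in> S" using SI[of "b * d"] * by simp
    have "f * g = eval2 (a * c) x y / eval2 (b * d) x y"
      using * nz by (simp add: eval2.map_mult)
    then show "f * g \<in> S" using SI[of "b * d"] * by simp
  next
    fix f assume "f \<in> S"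
    then obtain a b where *: "b \<noteq> 0" "f = eval2 a x y / eval2 b x y"
      unfolding S_def by blast
    have "- f = eval2 (- a) x y / eval2 b x y"
      using * by (simp add: eval2.map_uminus)
    then show "- f \<in> S" using SI[of b] * by simp
    show "inverse f \<in> S"
    proof (cases "a = 0")
      case True
      then show ?thesis using * \<open>f \<in> S\<close> by (simp add: eval2.map_zero)
    next
      case False
      have "inverse f = eval2 b x y / eval2 a x y" using * by simp
      then show ?thesis using SI[OF False] by simp
    qed
  qed
  moreover have "range const_fun \<subseteq> S"
  proof
    fix f :: "'a plane_function_field" assume "f \<in> range const_fun"
    then obtain c where "f = const_fun c" by blast
    then have "f = eval2 [:[:c:]:] x y / eval2 1 x y" by (simp add: eval2.map_one)
    then show "f \<in> S" using SI[of 1 "[:[:c:]:]"] by simp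
  qed
  moreover have "x \<in> S" using SI[of 1 "[:[:0, 1:]:]"] by (simp add: eval2.map_one)
  moreover have "y \<in> S" using SI[of 1 "[:0, 1:]"] by (simp add: eval2.map_one)
  ultimately have "S = UNIV" using assms(1) unfolding field_gens_def by blast
  then have "f \<in> S" by simp
  then show ?thesis unfolding S_def by blast
qed

text \<open>A relation between \<open>x\<close> and \<open>y / x\<close> becomes one between
  \<open>x\<close> and \<open>y\<close> after multiplication by \<open>x ^ N\<close>, where
  \<open>N\<close> bounds the exponents of the second variable. The exponent map is injective, so a
  nonzero relation stays nonzero.\<close>

lemma alg_indep_blowup_finite:
  assumes "alg_indep x y"
  shows "alg_indep x (y / x)"
  unfolding alg_indep_def
proof (intro allI impI)
  fix h assume h: "eval2 h x (y / x) = 0"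
  obtain N where N: "\<And>p. p \<in> supp2 h \<Longrightarrow> snd p \<le> N"
    using finite_nat_set_iff_bounded_le[of "snd ` supp2 h"] by (auto simp del: mem_supp2)
  let ?e = "\<lambda>p :: nat \<times> nat. (fst p + N - snd p, snd p)"
  have inj: "inj_on ?e (supp2 h)"
    using N by (intro inj_onI) (auto simp: prod_eq_iff simp del: mem_supp2 dest!: N)
  have "eval2 (reindex ?e h) x y = x ^ N * eval2 h x (y / x)"
    unfolding eval2_reindex eval2_supp2[of h] sum_distrib_left
  proof (rule sum.cong[OF refl])
    fix p assume "p \<in> supp2 h"
    then have "fst p + N = (fst p + N - snd p) + snd p" using N by fastforce
    then have "x ^ N * x ^ fst p = x ^ (fst p + N - snd p) * x ^ snd p"
      by (metis add.commute power_add)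
    then show "const_fun (coeff2 h p) * x ^ fst (?e p) * y ^ snd (?e p) =
        x ^ N * (const_fun (coeff2 h p) * x ^ fst p * (y / x) ^ snd p)"
      using alg_indep_nonzero[OF assms] by (simp add: power_divide field_simps)
  qed
  then have "reindex ?e h = 0" using h alg_indepD[OF assms] by simp
  then show "h = 0" using reindex_nonzero[OF inj] by blast
qed

lemma alg_indep_blowup_infinite:
  assumes "alg_indep x y"
  shows "alg_indep (x / y) y"
  unfolding alg_indep_def
proof (intro allI impI)
  fix h assume h: "eval2 h (x / y) y = 0"
  obtain N where N: "\<And>p. p \<in> supp2 h \<Longrightarrow> fst p \<le> N"
    using finite_nat_set_iff_bounded_le[of "fst ` supp2 h"] by (auto simp del: mem_supp2)
  let ?e = "\<lambda>p :: nat \<times> nat. (fst p, snd p + N - fst p)"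
  have inj: "inj_on ?e (supp2 h)"
    using N by (intro inj_onI) (auto simp: prod_eq_iff simp del: mem_supp2 dest!: N)
  have "eval2 (reindex ?e h) x y = y ^ N * eval2 h (x / y) y"
    unfolding eval2_reindex eval2_supp2[of h] sum_distrib_left
  proof (rule sum.cong[OF refl])
    fix p assume "p \<in> supp2 h"
    then have "snd p + N = (snd p + N - fst p) + fst p" using N by fastforce
    then have "y ^ N * y ^ snd p = y ^ (snd p + N - fst p) * y ^ fst p"
      by (metis add.commute power_add)
    then show "const_fun (coeff2 h p) * x ^ fst (?e p) * y ^ snd (?e p) =
        y ^ N * (const_fun (coeff2 h p) * (x / y) ^ fst p * y ^ snd p)"
      using alg_indep_nonzero[OF assms] by (simp add: power_divide field_simps)
  qed
  then have "reindex ?e h = 0" using h alg_indepD[OF assms] by simp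
  then show "h = 0" using reindex_nonzero[OF inj] by blast
qed

lemma eval2_pcompose: "eval2 (pcompose h [:[:c:], 1:]) x y = eval2 h x (y + const_fun c)"
proof (induction h)
  case 0
  then show ?case by (simp add: eval2.map_zero)
next
  case (pCons a h)
  have 1: "eval2 (pCons a h) x z = eval2 [:a:] x z + z * eval2 h x z" for z
    by (simp add: eval2_def map_poly_pCons const_fun.map_zero)
  have 2: "eval2 [:a:] x z = eval2 [:a:] x y" for z
    by (simp add: eval2_def map_poly_pCons const_fun.map_zero)
  have 3: "eval2 [:[:c:], 1:] x y = y + const_fun c"
    by (simp add: eval2_def map_poly_pCons const_fun.map_zero const_fun.map_one)
  show ?case
    unfolding pcompose_pCons eval2.map_add eval2.map_mult pCons 3 1[of "y + const_fun c"]
      2[of "y + const_fun c"] ..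
qed

lemma alg_indep_translate:
  assumes "alg_indep x y"
  shows "alg_indep x (y - const_fun c)"
  unfolding alg_indep_def
proof (intro allI impI)
  fix h assume "eval2 h x (y - const_fun c) = 0"
  then have "eval2 (pcompose h [:[:- c:], 1:]) x y = 0"
    by (simp add: eval2_pcompose const_fun.map_uminus)
  then have "pcompose h [:[:- c:], 1:] = 0" using alg_indepD[OF assms] by simp
  then show "h = 0" by (rule pcompose_eq_0) simp
qed

section \<open>Coordinate changes and orders along a divisor\<close>

lemma eval2_linear [simp]: "eval2 [:[:c, d:], [:e:]:] x y = const_fun c + const_fun d * x + const_fun e * y"
  by (simp add: eval2_def map_poly_pCons const_fun.map_zero algebra_simps)

interpretation to_fract: comm_ring_map to_fract
  by unfold_locales simp_all

lemma to_fract_monom2: "to_fract (monom (monom c i) j) = const_fun c * to_fract [:[:0, 1:]:] ^ i * to_fract [:0, 1:] ^ j"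
proof -
  have "monom (monom c i) j = [:[:c:]:] * [:[:0, 1:]:] ^ i * [:0, 1:] ^ j"
    by (rule coeff2_eqI) (simp add: coeff2_def monom_altdef poly_const_pow)
  then show ?thesis by (simp only: to_fract.map_mult to_fract.map_power const_fun_def)
qed

lemma eval2_reference: "eval2 h (to_fract [:[:0, 1:]:]) (to_fract [:0, 1:]) = to_fract h"
proof -
  have "to_fract h = to_fract (reindex (\<lambda>p. p) h)" by (simp add: reindex_id)
  also have "\<dots> = eval2 h (to_fract [:[:0, 1:]:]) (to_fract [:0, 1:])"
    unfolding reindex_def eval2_supp2 to_fract.map_sum to_fract_monom2 ..
  finally show ?thesis by simp
qed

text \<open>Multiplying \<open>1\<close>, \<open>u\<close>, \<open>v\<close> by the first linear
  form \<open>a 1\<close> gives the image of the reference coordinates under the matrix, so the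
  inverse matrix recovers the reference coordinates from \<open>u\<close> and \<open>v\<close> up to
  that common factor.\<close>

lemma affine_coordinates_good:
  assumes "affine_coordinates_at p u v"
  shows "alg_indep u v" "field_gens u v"
proof -
  obtain A :: "'a ^ 3 ^ 3" where A: "invertible A"
    and u: "u = linear_form (A $ 2) / linear_form (A $ 1)"
    and v: "v = linear_form (A $ 3) / linear_form (A $ 1)"
    using assms unfolding affine_coordinates_at_def by blast
  obtain B :: "'a ^ 3 ^ 3" where AB: "A ** B = mat 1" and BA: "B ** A = mat 1"
    using A unfolding invertible_def by blast
  define W2 W3 :: "'a plane_function_field"
    where "W2 = to_fract [:[:0, 1:]:]" and "W3 = to_fract [:0, 1:]"
  define a where "a k = linear_form (A $ k)" for k
  define b where "b k = linear_form (B $ k)" for k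
  have lf: "linear_form l = const_fun (l $ 1) + const_fun (l $ 2) * W2 + const_fun (l $ 3) * W3"
    for l :: "'a ^ 3"
    by (simp add: linear_form_def W2_def W3_def)
  have comb: "const_fun (c $ 1) * linear_form (M $ 1) + const_fun (c $ 2) * linear_form (M $ 2)
      + const_fun (c $ 3) * linear_form (M $ 3) = linear_form (c v* M)" for c and M :: "'a ^ 3 ^ 3"
    by (simp add: lf vector_matrix_mult_def sum_3 const_fun.map_add const_fun.map_mult algebra_simps)
  have row: "M $ k v* N = (M ** N) $ k" for M N :: "'a ^ 3 ^ 3" and k
    by (simp add: vector_matrix_mult_def matrix_matrix_mult_def vec_eq_iff mult.commute)
  have e1: "linear_form ((mat 1 :: 'a ^ 3 ^ 3) $ 1) = 1"
    and e2: "linear_form ((mat 1 :: 'a ^ 3 ^ 3) $ 2) = W2"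
    and e3: "linear_form ((mat 1 :: 'a ^ 3 ^ 3) $ 3) = W3"
    by (simp_all add: lf mat_def const_fun.map_zero const_fun.map_one)
  have Ab: "const_fun (A $ k $ 1) * b 1 + const_fun (A $ k $ 2) * b 2 + const_fun (A $ k $ 3) * b 3
      = linear_form (mat 1 $ k)" for k
    unfolding b_def by (simp add: comb row AB)
  have Ba: "const_fun (B $ k $ 1) * a 1 + const_fun (B $ k $ 2) * a 2 + const_fun (B $ k $ 3) * a 3
      = linear_form (mat 1 $ k)" for k
    unfolding a_def by (simp add: comb row BA)
  have lf0: "l = 0" if "linear_form l = 0" for l :: "'a ^ 3"
  proof -
    have "linear_form l = to_fract [:[:l $ 1, l $ 2:], [:l $ 3:]:]"
      unfolding lf W2_def W3_def by (subst eval2_reference[symmetric]) simp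
    then have "[:[:l $ 1, l $ 2:], [:l $ 3:]:] = 0" using that by simp
    then show ?thesis by (simp add: vec_eq_iff forall_3)
  qed
  have row_nz: "M $ 1 \<noteq> 0" if "M ** N = mat 1" for M N :: "'a ^ 3 ^ 3"
  proof
    assume "M $ 1 = 0"
    then have "(M ** N) $ 1 $ 1 = 0" by (simp add: matrix_matrix_mult_def)
    then show False using that by (simp add: mat_def)
  qed
  have a1: "a 1 \<noteq> 0" using row_nz[OF AB] lf0 unfolding a_def by blast
  have b1: "b 1 \<noteq> 0" using row_nz[OF BA] lf0 unfolding b_def by blast
  have u': "a 2 = u * a 1" and v': "a 3 = v * a 1"
    using a1 by (simp_all add: u v a_def)
  show "field_gens u v"
    unfolding field_gens_def
  proof (intro allI impI)
    fix S assume S: "subfield S \<and> range const_fun \<subseteq> S \<and> u \<in> S \<and> v \<in> S"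
    note closed = subfield_closed[of S]
    have lin: "const_fun c + const_fun d * u + const_fun e * v \<in> S" for c d e
      using S subfield_eval2[of S u v "[:[:c, d:], [:e:]:]"] by simp
    have lin_eq: "(const_fun (B $ k $ 1) + const_fun (B $ k $ 2) * u + const_fun (B $ k $ 3) * v) * a 1
        = linear_form (mat 1 $ k)" for k
      unfolding Ba[of k, symmetric] u' v' by (simp add: algebra_simps)
    \<comment> \<open>Row 1 of the inverse relation says that \<open>a 1\<close> times an affine
      linear expression in \<open>u\<close>, \<open>v\<close> is 1, so that expression is
      \<open>inverse (a 1)\<close>. Rows 2 and 3 then give \<open>W2\<close> and
      \<open>W3\<close>.\<close>
    have "inverse (a 1) \<in> S"
      using lin_eq[of 1] lin a1 e1 by (metis inverse_unique mult.commute inverse_inverse_eq)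
    then have a1S: "a 1 \<in> S" using S unfolding subfield_def by (metis inverse_inverse_eq)
    have W: "W2 \<in> S" "W3 \<in> S"
      using lin_eq[of 2] lin_eq[of 3] e2 e3 closed(2) S a1S lin by metis+
    have "f \<in> S" for f
    proof -
      obtain q r where "f = to_fract q / to_fract r"
        by (cases f) (auto simp: Fract_conv_to_fract)
      moreover have "to_fract h \<in> S" for h
        using subfield_eval2[of S W2 W3 h] S W eval2_reference[of h] by (simp add: W2_def W3_def)
      ultimately show ?thesis using closed(4) S by simp
    qed
    then show "S = UNIV" by blast
  qed
  show "alg_indep u v"
    unfolding alg_indep_def
  proof (intro allI impI)
    fix h assume h: "eval2 h u v = 0"
    obtain N where N: "\<And>p. p \<in> supp2 h \<Longrightarrow> fst p + snd p \<le> N"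
      using finite_nat_set_iff_bounded_le[of "(\<lambda>p. fst p + snd p) ` supp2 h"]
      by (auto simp del: mem_supp2)
    define L where "L k = [:[:A $ k $ 1, A $ k $ 2:], [:A $ k $ 3:]:]" for k
    define P where "P = (\<Sum>p\<in>supp2 h. [:[:coeff2 h p:]:] * L 1 ^ (N - fst p - snd p) * L 2 ^ fst p * L 3 ^ snd p)"
    \<comment> \<open>Homogenise \<open>h\<close> and substitute the inverse change of coordinates.\<close>
    have homog: "(\<Sum>p\<in>supp2 h. const_fun (coeff2 h p) * s ^ (N - fst p - snd p) * (x * s) ^ fst p * (y * s) ^ snd p)
        = s ^ N * eval2 h x y" for s x y
      unfolding eval2_supp2 sum_distrib_left
    proof (rule sum.cong[OF refl])
      fix p assume "p \<in> supp2 h"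
      then have "N = (N - fst p - snd p) + fst p + snd p" using N by fastforce
      then have "s ^ N = s ^ (N - fst p - snd p) * s ^ fst p * s ^ snd p" by (metis power_add)
      then show "const_fun (coeff2 h p) * s ^ (N - fst p - snd p) * (x * s) ^ fst p * (y * s) ^ snd p
          = s ^ N * (const_fun (coeff2 h p) * x ^ fst p * y ^ snd p)"
        by (simp add: power_mult_distrib)
    qed
    have evP: "eval2 P x y = (\<Sum>p\<in>supp2 h. const_fun (coeff2 h p) * eval2 (L 1) x y ^ (N - fst p - snd p)
        * eval2 (L 2) x y ^ fst p * eval2 (L 3) x y ^ snd p)" for x y
      unfolding P_def by (simp only: eval2.map_sum eval2.map_mult eval2.map_power eval2_const)
    have "eval2 (L k) W2 W3 = a k" for k
      by (simp add: L_def a_def lf)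
    then have "eval2 P W2 W3 = a 1 ^ N * eval2 h u v"
      unfolding evP using homog[of "a 1" u v] by (simp add: u' v')
    then have "to_fract P = 0" using h eval2_reference[of P] by (simp add: W2_def W3_def)
    then have "P = 0" by simp
    \<comment> \<open>At the point given by the inverse matrix the linear forms return the reference
      coordinates divided by \<open>b 1\<close>; hence \<open>P = 0\<close> forces \<open>h\<close>
      to vanish at the independent pair \<open>W2\<close>, \<open>W3\<close>.\<close>
    have "eval2 (L k) (b 2 / b 1) (b 3 / b 1) = linear_form (mat 1 $ k) / b 1" for k
      unfolding Ab[of k, symmetric] L_def using b1 by (simp add: field_simps)
    then have "eval2 P (b 2 / b 1) (b 3 / b 1) = inverse (b 1) ^ N * eval2 h W2 W3"
      unfolding evP using homog[of "inverse (b 1)" W2 W3] by (simp add: e1 e2 e3 divide_inverse)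
    then have "eval2 h W2 W3 = 0" using b1 by (simp add: \<open>P = 0\<close> eval2.map_zero)
    then show "h = 0" using eval2_reference[of h] by (simp add: W2_def W3_def)
  qed
qed

lemma field_gens_blowup:
  assumes "field_gens x y" "x \<noteq> 0" "y \<noteq> 0"
  shows "field_gens x (y / x - const_fun c)" "field_gens (x / y) y"
proof -
  show "field_gens x (y / x - const_fun c)"
    unfolding field_gens_def
  proof (intro allI impI)
    fix S assume S: "subfield S \<and> range const_fun \<subseteq> S \<and> x \<in> S \<and> y / x - const_fun c \<in> S"
    then have "x * ((y / x - const_fun c) + const_fun c) \<in> S"
      by (intro subfield_closed(1,2)) auto
    then have "y \<in> S" using assms(2) by simp
    then show "S = UNIV" using S assms(1) unfolding field_gens_def by blast
  qed
  show "field_gens (x / y) y"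
    unfolding field_gens_def
  proof (intro allI impI)
    fix S assume S: "subfield S \<and> range const_fun \<subseteq> S \<and> x / y \<in> S \<and> y \<in> S"
    then have "x / y * y \<in> S"
      by (intro subfield_closed(2)) auto
    then have "x \<in> S" using assms(3) by simp
    then show "S = UNIV" using S assms(1) unfolding field_gens_def by blast
  qed
qed

lemma blowup_coordinates_good:
  assumes "blowup_coordinates u v x y" "alg_indep u v" "field_gens u v"
  shows "alg_indep x y \<and> field_gens x y"
  using assms
proof (induction rule: blowup_coordinates.induct)
  case base
  then show ?case by simp
next
  case (finite_point x y c)
  then show ?case
    using alg_indep_translate[OF alg_indep_blowup_finite] field_gens_blowup(1) alg_indep_nonzero by blast
next
  case (infinite_point x y)
  then show ?case
    using alg_indep_blowup_infinite field_gens_blowup(2) alg_indep_nonzero by blast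
qed

section \<open>Restriction to the divisor of the first coordinate\<close>

definition slice :: "nat \<Rightarrow> 'a::field poly poly \<Rightarrow> 'a poly" where
  "slice k h = map_poly (\<lambda>q. coeff q k) h"

lemma coeff_slice: "coeff (slice k h) j = coeff2 h (k, j)"
  by (simp add: slice_def coeff_map_poly coeff2_def)

lemma slice_pcompose: "slice k (pcompose h [:[:c:], 1:]) = pcompose (slice k h) [:c, 1:]"
proof (induction h)
  case 0
  then show ?case by (simp add: slice_def)
next
  case (pCons a h)
  have 1: "slice k ([:a:] + g) = [:coeff a k:] + slice k g" for g
    by (rule poly_eqI) (simp add: coeff_slice coeff2_def coeff_pCons split: nat.split)
  have 2: "slice k ([:[:c:], 1:] * g) = [:c, 1:] * slice k g" for g
    by (rule poly_eqI) (simp add: coeff_slice coeff2_def coeff_pCons split: nat.split)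
  have 3: "slice k (pCons a h) = pCons (coeff a k) (slice k h)"
    by (simp add: slice_def map_poly_pCons)
  show ?case
    unfolding pcompose_pCons 1 2 3 pCons ..
qed

lemma slice_0_mult: "slice 0 (f * g) = slice 0 f * slice 0 g"
  by (rule poly_eqI) (simp add: coeff_slice coeff2_def coeff_mult coeff_sum)

lemma slice_0_one [simp]: "slice 0 1 = 1"
  by (simp add: slice_def)

lemma coeff2_reindex_inj:
  assumes "inj e"
  shows "coeff2 (reindex e h) (e p) = coeff2 h p"
proof (cases "coeff2 h p = 0")
  case True
  then show ?thesis
    using coeff2_reindex_outside[of h e "e p"] assms by (metis injD)
next
  case False
  then show ?thesis using coeff2_reindex inj_on_subset[OF assms] by blast
qed

text \<open>The Izumi-type comparison between the orders of vanishing at two infinitely near points.\<close>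

definition dominates ::
  "'a::field plane_function_field \<Rightarrow> 'a plane_function_field \<Rightarrow>
   'a plane_function_field \<Rightarrow> 'a plane_function_field \<Rightarrow> nat \<Rightarrow> bool" where
  "dominates u v x y C \<longleftrightarrow> (\<forall>h. \<exists>g. eval2 h u v = eval2 g x y \<and> coeff2 g (0, 0) = coeff2 h (0, 0) \<and>
     (\<forall>p. coeff2 h p \<noteq> 0 \<longrightarrow> (\<exists>q. coeff2 g q \<noteq> 0 \<and> fst q + snd q \<le> C * (fst p + snd p))))"

lemma dominates_refl: "dominates u v u v 1"
  by (auto simp: dominates_def)

lemma dominates_trans:
  assumes "dominates u v x y C" "dominates x y x' y' D"
  shows "dominates u v x' y' (D * C)"
  unfolding dominates_def
proof
  fix h
  obtain g where g: "eval2 h u v = eval2 g x y" "coeff2 g (0, 0) = coeff2 h (0, 0)"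
    "\<And>p. coeff2 h p \<noteq> 0 \<Longrightarrow> \<exists>q. coeff2 g q \<noteq> 0 \<and> fst q + snd q \<le> C * (fst p + snd p)"
    using assms(1) unfolding dominates_def by meson
  obtain k where k: "eval2 g x y = eval2 k x' y'" "coeff2 k (0, 0) = coeff2 g (0, 0)"
    "\<And>p. coeff2 g p \<noteq> 0 \<Longrightarrow> \<exists>q. coeff2 k q \<noteq> 0 \<and> fst q + snd q \<le> D * (fst p + snd p)"
    using assms(2) unfolding dominates_def by meson
  have "\<exists>q. coeff2 k q \<noteq> 0 \<and> fst q + snd q \<le> D * C * (fst p + snd p)" if "coeff2 h p \<noteq> 0" for p
  proof -
    obtain q where q: "coeff2 g q \<noteq> 0" "fst q + snd q \<le> C * (fst p + snd p)"
      using g(3) \<open>coeff2 h p \<noteq> 0\<close> by blast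
    obtain r where "coeff2 k r \<noteq> 0" "fst r + snd r \<le> D * (fst q + snd q)"
      using k(3) q(1) by blast
    moreover have "D * (fst q + snd q) \<le> D * (C * (fst p + snd p))"
      using q(2) by (rule mult_le_mono2)
    ultimately show ?thesis by (metis le_trans mult.assoc)
  qed
  then show "\<exists>g. eval2 h u v = eval2 g x' y' \<and> coeff2 g (0, 0) = coeff2 h (0, 0) \<and>
     (\<forall>p. coeff2 h p \<noteq> 0 \<longrightarrow> (\<exists>q. coeff2 g q \<noteq> 0 \<and> fst q + snd q \<le> D * C * (fst p + snd p)))"
    using g k by (intro exI[of _ k]) auto
qed

lemma eval2_blowup:
  assumes "x \<noteq> 0"
  shows "eval2 (reindex (\<lambda>p. (fst p + snd p, snd p)) h) x (y / x) = eval2 h x y"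
  unfolding eval2_reindex eval2_supp2[of h]
  using assms by (intro sum.cong) (simp_all add: power_add power_divide)

text \<open>A monomial of degree \<open>k\<close> becomes \<open>x ^ k\<close> times at most the
  \<open>k\<close>-th power of \<open>y / x\<close>. So the coefficient of \<open>x ^ k\<close> is a
  polynomial in \<open>y / x\<close> of degree at most \<open>k\<close>, and translation by
  \<open>c\<close> keeps it nonzero and of the same degree. Its leading monomial yields total degree
  at most \<open>2 * k\<close>, whence the factor 2.\<close>

lemma dominates_finite_point:
  assumes "x \<noteq> 0"
  shows "dominates x y x (y / x - const_fun c) 2"
  unfolding dominates_def
proof
  fix h
  let ?e = "\<lambda>p :: nat \<times> nat. (fst p + snd p, snd p)"
  let ?g = "pcompose (reindex ?e h) [:[:c:], 1:]"
  have inj: "inj ?e" by (rule injI) (simp add: prod_eq_iff)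
  have out: "coeff2 (reindex ?e h) (k, j) = 0" if "k < j" for k j
    using that by (intro coeff2_reindex_outside) auto
  have "eval2 h x y = eval2 ?g x (y / x - const_fun c)"
    unfolding eval2_pcompose using eval2_blowup[OF assms, of h y] by simp
  moreover have "coeff2 ?g (0, 0) = coeff2 h (0, 0)"
  proof -
    have "slice 0 (reindex ?e h) = [:coeff2 h (0, 0):]"
    proof (rule poly_eqI)
      fix j
      show "coeff (slice 0 (reindex ?e h)) j = coeff [:coeff2 h (0, 0):] j"
        using coeff2_reindex_inj[OF inj, of h "(0, 0)"] out[of 0 j]
        by (cases j) (simp_all add: coeff_slice)
    qed
    then show ?thesis by (simp add: coeff_slice[symmetric] slice_pcompose)
  qed
  moreover have "\<exists>q. coeff2 ?g q \<noteq> 0 \<and> fst q + snd q \<le> 2 * (fst p + snd p)" if "coeff2 h p \<noteq> 0" for p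
  proof -
    define k where "k = fst p + snd p"
    define s where "s = slice k (reindex ?e h)"
    have "coeff s (snd p) \<noteq> 0"
      using coeff2_reindex_inj[OF inj, of h p] that by (simp add: s_def coeff_slice k_def)
    then have "s \<noteq> 0" by auto
    then have "pcompose s [:c, 1:] \<noteq> 0" using pcompose_eq_0[of s "[:c, 1:]"] by auto
    then have "coeff2 ?g (k, degree (pcompose s [:c, 1:])) \<noteq> 0"
      by (simp add: coeff_slice[symmetric] slice_pcompose s_def)
    moreover have "degree s \<le> k"
      by (rule degree_le) (simp add: s_def coeff_slice out)
    then have "degree (pcompose s [:c, 1:]) \<le> k" by (simp add: degree_pcompose)
    ultimately show ?thesis by (intro exI[of _ "(k, degree (pcompose s [:c, 1:]))"]) (simp add: k_def)
  qed
  ultimately show "\<exists>g. eval2 h x y = eval2 g x (y / x - const_fun c) \<and> coeff2 g (0, 0) = coeff2 h (0, 0) \<and>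
     (\<forall>p. coeff2 h p \<noteq> 0 \<longrightarrow> (\<exists>q. coeff2 g q \<noteq> 0 \<and> fst q + snd q \<le> 2 * (fst p + snd p)))"
    by (intro exI[of _ ?g]) simp
qed

text \<open>Here \<open>x ^ i * y ^ j\<close> becomes \<open>(x / y) ^ i * y ^ (i + j)\<close>, of
  degree \<open>2 * i + j\<close>; without a translation single coefficients survive.\<close>

lemma dominates_infinite_point:
  assumes "y \<noteq> 0"
  shows "dominates x y (x / y) y 2"
  unfolding dominates_def
proof
  fix h
  let ?e = "\<lambda>p :: nat \<times> nat. (fst p, fst p + snd p)"
  have inj: "inj ?e" by (rule injI) (simp add: prod_eq_iff)
  have "eval2 h x y = eval2 (reindex ?e h) (x / y) y"
    unfolding eval2_reindex eval2_supp2[of h]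
    using assms by (intro sum.cong) (simp_all add: power_add power_divide)
  moreover have "coeff2 (reindex ?e h) (0, 0) = coeff2 h (0, 0)"
    using coeff2_reindex_inj[OF inj, of h "(0, 0)"] by simp
  moreover have "\<exists>q. coeff2 (reindex ?e h) q \<noteq> 0 \<and> fst q + snd q \<le> 2 * (fst p + snd p)"
    if "coeff2 h p \<noteq> 0" for p
    using coeff2_reindex_inj[OF inj, of h p] that by (intro exI[of _ "?e p"]) simp
  ultimately show "\<exists>g. eval2 h x y = eval2 g (x / y) y \<and> coeff2 g (0, 0) = coeff2 h (0, 0) \<and>
     (\<forall>p. coeff2 h p \<noteq> 0 \<longrightarrow> (\<exists>q. coeff2 g q \<noteq> 0 \<and> fst q + snd q \<le> 2 * (fst p + snd p)))"
    by (intro exI[of _ "reindex ?e h"]) simp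
qed

lemma blowup_coordinates_dominates:
  assumes "blowup_coordinates u v x y" "alg_indep u v" "field_gens u v"
  shows "\<exists>C. dominates u v x y C"
  using assms
proof (induction rule: blowup_coordinates.induct)
  case base
  then show ?case using dominates_refl by blast
next
  case (finite_point x y c)
  then have "x \<noteq> 0" using blowup_coordinates_good alg_indep_nonzero by blast
  then show ?case using finite_point dominates_trans dominates_finite_point by blast
next
  case (infinite_point x y)
  then have "y \<noteq> 0" using blowup_coordinates_good alg_indep_nonzero by blast
  then show ?case using infinite_point dominates_trans dominates_infinite_point by blast
qed

section \<open>Orders of vanishing along a divisor\<close>

definition has_order ::
  "'a::field plane_function_field \<Rightarrow> 'a plane_function_field \<Rightarrow> 'a plane_function_field \<Rightarrow> int \<Rightarrow> bool"
  where "has_order x w f k \<longleftrightarrow> (\<exists>a b. slice 0 a \<noteq> 0 \<and> slice 0 b \<noteq> 0 \<and>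
     f = (x powi k) * (eval2 a x w / eval2 b x w))"

text \<open>The relational form allows existence and uniqueness to be settled before the definite
  description is used.\<close>

lemma exceptional_order_has_order: "exceptional_order x y f = (THE k. has_order x (y / x) f k)"
  by (simp add: exceptional_order_def has_order_def slice_def)

context
  fixes x w :: "'a::field plane_function_field"
  assumes indep: "alg_indep x w"
begin

lemma x_nonzero: "x \<noteq> 0"
  using alg_indep_nonzero[OF indep] by blast

lemma slice_0_eval2_nonzero: "slice 0 a \<noteq> 0 \<Longrightarrow> eval2 a x w \<noteq> 0"
  using alg_indepD[OF indep, of a] by (auto simp: slice_def)

text \<open>Cross-multiplying two representations of different order gives, by independence, an
  identity of polynomials in which one side carries a positive power of the first variable.
  Restricted to \<open>x = 0\<close> that side vanishes and the other does not.\<close>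

lemma has_order_not_less:
  assumes "has_order x w f k" "has_order x w f l"
  shows "\<not> k < l"
proof
  assume "k < l"
  obtain a b where a: "slice 0 a \<noteq> 0" "slice 0 b \<noteq> 0" "f = (x powi k) * (eval2 a x w / eval2 b x w)"
    using assms(1) unfolding has_order_def by blast
  obtain c d where c: "slice 0 c \<noteq> 0" "slice 0 d \<noteq> 0" "f = (x powi l) * (eval2 c x w / eval2 d x w)"
    using assms(2) unfolding has_order_def by blast
  obtain n where n: "l = k + int (Suc n)"
    using \<open>k < l\<close> by (metis zless_iff_Suc_zadd)
  let ?X = "[:[:0, 1:]:] :: 'a poly poly"
  have "x powi l = x powi k * x ^ Suc n"
    unfolding n using x_nonzero by (subst power_int_add) (simp_all only: power_int_of_nat simp_thms)
  then have "x powi k * (eval2 a x w / eval2 b x w) = x powi k * (x ^ Suc n * (eval2 c x w / eval2 d x w))"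
    using a(3) c(3) by (simp only: mult.assoc)
  then have "eval2 a x w / eval2 b x w = x ^ Suc n * (eval2 c x w / eval2 d x w)"
    using x_nonzero by (simp only: mult_cancel_left power_int_eq_0_iff simp_thms)
  then have "eval2 a x w * eval2 d x w = x ^ Suc n * eval2 c x w * eval2 b x w"
    using slice_0_eval2_nonzero[OF a(2)] slice_0_eval2_nonzero[OF c(2)] by (simp add: field_simps)
  then have "eval2 (a * d) x w = eval2 (?X ^ Suc n * c * b) x w"
    by (simp only: eval2.map_mult eval2.map_power eval2_X)
  then have "a * d = ?X ^ Suc n * c * b" by (rule alg_indep_cancel[OF indep])
  then have "slice 0 a * slice 0 d = slice 0 ?X * slice 0 (?X ^ n * c * b)"
    by (metis slice_0_mult mult.assoc power_Suc)
  moreover have "slice 0 ?X = 0" by (simp add: slice_def map_poly_pCons)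
  ultimately show False using a(1) c(2) by simp
qed

lemma has_order_unique: "has_order x w f k \<Longrightarrow> has_order x w f l \<Longrightarrow> k = l"
  using has_order_not_less by (meson linorder_neqE)

lemma has_order_mult:
  assumes "has_order x w f k" "has_order x w g l"
  shows "has_order x w (f * g) (k + l)"
proof -
  obtain a b where a: "slice 0 a \<noteq> 0" "slice 0 b \<noteq> 0" "f = (x powi k) * (eval2 a x w / eval2 b x w)"
    using assms(1) unfolding has_order_def by blast
  obtain c d where c: "slice 0 c \<noteq> 0" "slice 0 d \<noteq> 0" "g = (x powi l) * (eval2 c x w / eval2 d x w)"
    using assms(2) unfolding has_order_def by blast
  have "f * g = (x powi (k + l)) * (eval2 (a * c) x w / eval2 (b * d) x w)"
    using x_nonzero by (simp add: a c power_int_add eval2.map_mult)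
  then show ?thesis
    unfolding has_order_def using a c by (metis slice_0_mult no_zero_divisors)
qed

lemma has_order_inverse:
  assumes "has_order x w f k"
  shows "has_order x w (inverse f) (- k)"
proof -
  obtain a b where a: "slice 0 a \<noteq> 0" "slice 0 b \<noteq> 0" "f = (x powi k) * (eval2 a x w / eval2 b x w)"
    using assms(1) unfolding has_order_def by blast
  then have "inverse f = (x powi (- k)) * (eval2 b x w / eval2 a x w)"
    by (simp add: power_int_minus divide_inverse mult_ac)
  then show ?thesis unfolding has_order_def using a by blast
qed

lemma has_order_power_int: "has_order x w (x powi k) k"
  unfolding has_order_def by (intro exI[of _ 1]) (simp add: eval2.map_one)

lemma has_order_eval2:
  assumes "\<And>p. coeff2 a p \<noteq> 0 \<Longrightarrow> n \<le> fst p" "coeff2 a (n, j) \<noteq> 0"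
  shows "has_order x w (eval2 a x w) (int n)"
proof -
  let ?e = "\<lambda>p :: nat \<times> nat. (fst p - n, snd p)"
  have inj: "inj_on ?e (supp2 a)"
  proof (rule inj_onI)
    fix p q assume "p \<in> supp2 a" "q \<in> supp2 a" "?e p = ?e q"
    moreover from this have "n \<le> fst p" "n \<le> fst q" using assms(1) by simp_all
    ultimately show "p = q" by (auto simp: prod_eq_iff simp del: mem_supp2)
  qed
  have "coeff (slice 0 (reindex ?e a)) j \<noteq> 0"
    using coeff2_reindex[OF inj assms(2)] assms(2) by (simp add: coeff_slice)
  then have "slice 0 (reindex ?e a) \<noteq> 0" by auto
  moreover have "eval2 a x w = x ^ n * eval2 (reindex ?e a) x w"
    unfolding eval2_reindex eval2_supp2[of a] sum_distrib_left
  proof (rule sum.cong[OF refl])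
    fix p assume "p \<in> supp2 a"
    then have "n \<le> fst p" using assms(1) by simp
    then have "x ^ fst p = x ^ n * x ^ (fst p - n)" by (metis le_add_diff_inverse power_add)
    then show "const_fun (coeff2 a p) * x ^ fst p * w ^ snd p =
        x ^ n * (const_fun (coeff2 a p) * x ^ fst (?e p) * w ^ snd (?e p))"
      by simp
  qed
  ultimately show ?thesis
    unfolding has_order_def
    by (intro exI[of _ "reindex ?e a"] exI[of _ 1]) (simp add: eval2.map_one)
qed

lemma has_order_eval2_exists:
  assumes "a \<noteq> 0"
  shows "\<exists>n. has_order x w (eval2 a x w) (int n)"
proof -
  define n where "n = (LEAST i. \<exists>j. coeff2 a (i, j) \<noteq> 0)"
  have ex: "\<exists>i j. coeff2 a (i, j) \<noteq> 0"
    using coeff2_nonzero[OF assms] by auto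
  obtain j where "coeff2 a (n, j) \<noteq> 0"
    using LeastI_ex[OF ex] unfolding n_def by blast
  moreover have "n \<le> fst p" if "coeff2 a p \<noteq> 0" for p
    using that Least_le[of "\<lambda>i. \<exists>j. coeff2 a (i, j) \<noteq> 0" "fst p"] unfolding n_def
    by (metis prod.collapse)
  ultimately show ?thesis using has_order_eval2 by blast
qed

lemma has_order_exists:
  assumes "field_gens x w" "f \<noteq> 0"
  shows "\<exists>k. has_order x w f k"
proof -
  obtain a b where ab: "b \<noteq> 0" "f = eval2 a x w / eval2 b x w"
    using field_gens_fraction[OF assms(1) indep] by blast
  then have "a \<noteq> 0" using assms(2) by (auto simp: eval2.map_zero)
  then obtain n m where "has_order x w (eval2 a x w) (int n)" "has_order x w (eval2 b x w) (int m)"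
    using has_order_eval2_exists ab(1) by meson
  then have "has_order x w (eval2 a x w * inverse (eval2 b x w)) (int n + - int m)"
    by (intro has_order_mult has_order_inverse)
  then show ?thesis using ab by (metis divide_inverse)
qed

text \<open>Over the common denominator \<open>x powi k\<close> factors out. The remaining numerator
  is a polynomial, so its own order is a natural number and the total order cannot drop below
  \<open>k\<close>.\<close>

lemma has_order_add:
  assumes "has_order x w f k" "has_order x w g l" "f + g \<noteq> 0" "k \<le> l"
  shows "\<exists>n\<ge>k. has_order x w (f + g) n"
proof -
  obtain a b where a: "slice 0 a \<noteq> 0" "slice 0 b \<noteq> 0" "f = (x powi k) * (eval2 a x w / eval2 b x w)"
    using assms(1) unfolding has_order_def by blast
  obtain c d where c: "slice 0 c \<noteq> 0" "slice 0 d \<noteq> 0" "g = (x powi l) * (eval2 c x w / eval2 d x w)"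
    using assms(2) unfolding has_order_def by blast
  obtain n where n: "l = k + int n"
    using assms(4) zle_iff_zadd by blast
  let ?N = "a * d + [:[:0, 1:]:] ^ n * c * b"
  have "x powi l = x powi k * x ^ n"
    unfolding n using x_nonzero by (simp add: power_int_add)
  then have eq: "f + g = x powi k * (eval2 ?N x w * inverse (eval2 (b * d) x w))"
    using slice_0_eval2_nonzero[OF a(2)] slice_0_eval2_nonzero[OF c(2)]
    unfolding a(3) c(3)
    by (simp add: eval2.map_add eval2.map_mult eval2.map_power field_simps)
  then have "?N \<noteq> 0" using assms(3) by (metis eval2.map_zero mult_zero_left mult_zero_right)
  then obtain m where "has_order x w (eval2 ?N x w) (int m)"
    using has_order_eval2_exists by blast
  moreover have "has_order x w (eval2 (b * d) x w) 0"
    unfolding has_order_def using a(2) c(2)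
    by (intro exI[of _ "b * d"] exI[of _ 1]) (simp add: slice_0_mult eval2.map_one)
  ultimately have "has_order x w (f + g) (k + (int m + - 0))"
    unfolding eq by (intro has_order_mult has_order_inverse has_order_power_int)
  then show ?thesis by (intro exI[of _ "k + int m"]) simp
qed

end

section \<open>Divisorial valuations on the local ring\<close>

lemma coeff2_order_exists:
  assumes "h \<noteq> 0"
  obtains q where "coeff2 h q \<noteq> 0" "\<And>p. coeff2 h p \<noteq> 0 \<Longrightarrow> fst q + snd q \<le> fst p + snd p"
proof -
  obtain p0 where "coeff2 h p0 \<noteq> 0" using coeff2_nonzero[OF assms] by blast
  then show thesis
    using ex_has_least_nat[of "\<lambda>p. coeff2 h p \<noteq> 0" p0 "\<lambda>p. fst p + snd p"] that by blast
qed

lemma coeff2_one [simp]: "coeff2 1 (0, 0) = 1"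
  by (simp add: coeff2_def)

lemma triangle_mono: "m \<le> n \<Longrightarrow> triangle m \<le> triangle n"
  unfolding triangle_def by (intro div_le_mono mult_le_mono) auto

lemma prod_encode_mono:
  assumes "i \<le> i'" "j \<le> j'"
  shows "prod_encode (i, j) \<le> prod_encode (i', j')"
proof -
  have "triangle (i + j) \<le> triangle (i' + j')"
    using assms by (intro triangle_mono add_mono)
  then show ?thesis using assms by (simp add: prod_encode_def)
qed

text \<open>Each monomial dividing another one is listed no later, so the vanishing of all early
  coefficients passes to multiples; this makes \<open>encode_ideal\<close> below an ideal.\<close>

lemma coeff2_mult_encode:
  assumes "\<And>p. prod_encode p < s \<Longrightarrow> coeff2 a p = 0" "prod_encode q < s"
  shows "coeff2 (a * b) q = 0"
proof -
  obtain i j where q: "q = (i, j)" by (cases q)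
  have "coeff2 a (i', j') = 0" if "i' \<le> i" "j' \<le> j" for i' j'
    using prod_encode_mono[OF that] assms q by auto
  then show ?thesis unfolding q coeff2_mult by simp
qed

text \<open>The facts about a valuation centred at the origin of \<open>u\<close>, \<open>v\<close>
  on which the estimates rest. The last assumption is the Izumi-type bound; it gives the positive
  volume and the existence of the maximum defining \<open>mu\<close>.\<close>

locale plane_valuation =
  fixes u v :: "'a::field plane_function_field"
    and \<nu> :: "'a plane_function_field \<Rightarrow> int"
    and C :: nat
  assumes indep: "alg_indep u v"
    and val_mult: "f \<noteq> 0 \<Longrightarrow> g \<noteq> 0 \<Longrightarrow> \<nu> (f * g) = \<nu> f + \<nu> g"
    and val_add: "f \<noteq> 0 \<Longrightarrow> g \<noteq> 0 \<Longrightarrow> f + g \<noteq> 0 \<Longrightarrow> min (\<nu> f) (\<nu> g) \<le> \<nu> (f + g)"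
    and val_eval2_unit: "coeff2 h (0, 0) \<noteq> 0 \<Longrightarrow> \<nu> (eval2 h u v) = 0"
    and val_eval2_pos: "h \<noteq> 0 \<Longrightarrow> coeff2 h (0, 0) = 0 \<Longrightarrow> 0 < \<nu> (eval2 h u v)"
    and val_eval2_le: "coeff2 h p \<noteq> 0 \<Longrightarrow> \<nu> (eval2 h u v) \<le> int (C * (fst p + snd p))"

context
  fixes x y :: "'a::field plane_function_field"
  assumes indep: "alg_indep x y" and gens: "field_gens x y"
begin

lemma blowup_chart: "alg_indep x (y / x)" "field_gens x (y / x)"
  using alg_indep_blowup_finite[OF indep] field_gens_blowup(1)[OF gens, of 0] alg_indep_nonzero[OF indep]
  by (simp_all add: const_fun.map_zero)

lemma exceptional_order_eq: "has_order x (y / x) f k \<Longrightarrow> exceptional_order x y f = k"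
  unfolding exceptional_order_has_order using has_order_unique[OF blowup_chart(1)] by blast

lemma exceptional_order:
  assumes "f \<noteq> 0"
  shows "has_order x (y / x) f (exceptional_order x y f)"
  using has_order_exists[OF blowup_chart assms] exceptional_order_eq by blast

lemma exceptional_order_mult:
  assumes "f \<noteq> 0" "g \<noteq> 0"
  shows "exceptional_order x y (f * g) = exceptional_order x y f + exceptional_order x y g"
  using has_order_mult[OF blowup_chart(1) exceptional_order exceptional_order, OF assms]
  by (rule exceptional_order_eq)

lemma exceptional_order_add:
  assumes "f \<noteq> 0" "g \<noteq> 0" "f + g \<noteq> 0"
  shows "min (exceptional_order x y f) (exceptional_order x y g) \<le> exceptional_order x y (f + g)"
proof (cases "exceptional_order x y f \<le> exceptional_order x y g")
  case True
  then show ?thesis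
    using has_order_add[OF blowup_chart(1) exceptional_order exceptional_order, OF assms]
      exceptional_order_eq by fastforce
next
  case False
  then show ?thesis
    using has_order_add[OF blowup_chart(1) exceptional_order exceptional_order, of g f] assms
      exceptional_order_eq by (fastforce simp: add.commute)
qed

text \<open>The order along the exceptional divisor is the multiplicity at the blown up point:
  \<open>x ^ i * y ^ j\<close> is \<open>x ^ (i + j) * (y / x) ^ j\<close>, and distinct monomials
  of one degree differ in the power of \<open>y / x\<close>, so nothing cancels.\<close>

lemma exceptional_order_eval2:
  assumes "coeff2 h q \<noteq> 0" "\<And>p. coeff2 h p \<noteq> 0 \<Longrightarrow> fst q + snd q \<le> fst p + snd p"
  shows "exceptional_order x y (eval2 h x y) = int (fst q + snd q)"
proof -
  let ?e = "\<lambda>p :: nat \<times> nat. (fst p + snd p, snd p)"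
  have inj: "inj ?e" by (rule injI) (simp add: prod_eq_iff)
  have "has_order x (y / x) (eval2 (reindex ?e h) x (y / x)) (int (fst q + snd q))"
  proof (rule has_order_eval2[OF blowup_chart(1)])
    show "coeff2 (reindex ?e h) (fst q + snd q, snd q) \<noteq> 0"
      using coeff2_reindex_inj[OF inj, of h q] assms(1) by simp
    show "fst q + snd q \<le> fst p" if "coeff2 (reindex ?e h) p \<noteq> 0" for p
    proof (rule ccontr)
      assume less: "\<not> fst q + snd q \<le> fst p"
      have "coeff2 (reindex ?e h) p = 0"
      proof (rule coeff2_reindex_outside)
        fix p' assume "coeff2 h p' \<noteq> 0"
        then have "fst q + snd q \<le> fst p' + snd p'" by (rule assms(2))
        then show "?e p' \<noteq> p" using less by auto
      qed
      then show False using that by simp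
    qed
  qed
  then show ?thesis
    unfolding eval2_blowup[OF alg_indep_nonzero(1)[OF indep]] by (rule exceptional_order_eq)
qed

end

text \<open>By \<open>dominates\<close> a polynomial in \<open>u\<close>, \<open>v\<close> is also
  one in coordinates at the last centre, with the same constant term. There the valuation is the
  multiplicity, hence zero or positive according to that constant term, and bounded above through
  \<open>C\<close>.\<close>

lemma divisorial_plane_valuation:
  assumes "divisorial_valuation u v \<nu>" "alg_indep u v" "field_gens u v"
  shows "\<exists>C. plane_valuation u v \<nu> C"
proof -
  obtain x y where xy: "blowup_coordinates u v x y"
    and \<nu>: "\<And>f. f \<noteq> 0 \<Longrightarrow> \<nu> f = exceptional_order x y f"
    using assms(1) unfolding divisorial_valuation_def by blast
  note good = blowup_coordinates_good[OF xy assms(2,3), THEN conjunct1]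
    blowup_coordinates_good[OF xy assms(2,3), THEN conjunct2]
  obtain C where C: "dominates u v x y C"
    using blowup_coordinates_dominates[OF xy assms(2,3)] by blast
  have lift: "\<exists>g. g \<noteq> 0 \<and> coeff2 g (0, 0) = coeff2 h (0, 0) \<and> \<nu> (eval2 h u v) = exceptional_order x y (eval2 g x y) \<and>
     (\<forall>p. coeff2 h p \<noteq> 0 \<longrightarrow> (\<exists>q. coeff2 g q \<noteq> 0 \<and> fst q + snd q \<le> C * (fst p + snd p)))"
    if "h \<noteq> 0" for h
  proof -
    obtain g where g: "eval2 h u v = eval2 g x y" "coeff2 g (0, 0) = coeff2 h (0, 0)"
      "\<forall>p. coeff2 h p \<noteq> 0 \<longrightarrow> (\<exists>q. coeff2 g q \<noteq> 0 \<and> fst q + snd q \<le> C * (fst p + snd p))"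
      using C unfolding dominates_def by meson
    have "eval2 g x y \<noteq> 0" using that alg_indepD[OF assms(2), of h] g(1) by simp
    then have "g \<noteq> 0" by (auto simp: eval2.map_zero)
    moreover have "\<nu> (eval2 h u v) = exceptional_order x y (eval2 g x y)"
      unfolding g(1) using \<open>eval2 g x y \<noteq> 0\<close> by (rule \<nu>)
    ultimately show ?thesis using g by blast
  qed
  have "plane_valuation u v \<nu> C"
  proof
    show "alg_indep u v" by (rule assms(2))
    show "\<nu> (f * g) = \<nu> f + \<nu> g" if "f \<noteq> 0" "g \<noteq> 0" for f g
      using exceptional_order_mult[OF good] that by (simp add: \<nu>)
    show "min (\<nu> f) (\<nu> g) \<le> \<nu> (f + g)" if "f \<noteq> 0" "g \<noteq> 0" "f + g \<noteq> 0" for f g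
      using exceptional_order_add[OF good] that by (simp add: \<nu>)
    show "\<nu> (eval2 h u v) = 0" if "coeff2 h (0, 0) \<noteq> 0" for h
    proof -
      have "h \<noteq> 0" using that by auto
      then obtain g where "coeff2 g (0, 0) = coeff2 h (0, 0)"
        "\<nu> (eval2 h u v) = exceptional_order x y (eval2 g x y)"
        using lift by blast
      then show ?thesis using exceptional_order_eval2[OF good, of g "(0, 0)"] that by simp
    qed
    show "0 < \<nu> (eval2 h u v)" if h: "h \<noteq> 0" "coeff2 h (0, 0) = 0" for h
    proof -
      obtain g where g: "g \<noteq> 0" "coeff2 g (0, 0) = coeff2 h (0, 0)"
        "\<nu> (eval2 h u v) = exceptional_order x y (eval2 g x y)"
        using lift[OF h(1)] by blast
      obtain q where q: "coeff2 g q \<noteq> 0" "\<And>p. coeff2 g p \<noteq> 0 \<Longrightarrow> fst q + snd q \<le> fst p + snd p"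
        using coeff2_order_exists[OF g(1)] by blast
      have "q \<noteq> (0, 0)" using q(1) g(2) h(2) by auto
      then show ?thesis using exceptional_order_eval2[OF good q] g(3) by (cases q) auto
    qed
    show "\<nu> (eval2 h u v) \<le> int (C * (fst p + snd p))" if p: "coeff2 h p \<noteq> 0" for h p
    proof -
      have "h \<noteq> 0" using p by auto
      obtain g where g: "g \<noteq> 0" "\<nu> (eval2 h u v) = exceptional_order x y (eval2 g x y)"
        "\<exists>q. coeff2 g q \<noteq> 0 \<and> fst q + snd q \<le> C * (fst p + snd p)"
        using lift[OF \<open>h \<noteq> 0\<close>] p by blast
      obtain q where q: "coeff2 g q \<noteq> 0" "\<And>p. coeff2 g p \<noteq> 0 \<Longrightarrow> fst q + snd q \<le> fst p + snd p"
        using coeff2_order_exists[OF g(1)] by blast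
      have "fst q + snd q \<le> C * (fst p + snd p)" using q(2) g(3) le_trans by blast
      then show ?thesis using exceptional_order_eval2[OF good q] g(2) by (metis of_nat_le_iff)
    qed
  qed
  then show ?thesis by blast
qed

section \<open>The local ring and its valuation ideals\<close>

context plane_valuation
begin

lemma eval2_nonzero_iff [simp]: "eval2 h u v = 0 \<longleftrightarrow> h = 0"
  using alg_indepD[OF indep] .

lemma coeff2_00_nonzero: "coeff2 h (0, 0) \<noteq> 0 \<Longrightarrow> h \<noteq> 0"
  by auto

lemma uv_nonzero: "u \<noteq> 0" "v \<noteq> 0"
  using alg_indep_nonzero[OF indep] .

lemma val_u_pos: "0 < \<nu> u"
  using val_eval2_pos[of "[:[:0, 1:]:]"] by (simp add: coeff2_def)

lemma val_v_pos: "0 < \<nu> v"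
  using val_eval2_pos[of "[:0, 1:]"] by (simp add: coeff2_def)

lemma C_pos: "0 < C"
proof (rule ccontr)
  assume "\<not> 0 < C"
  then show False
    using val_eval2_le[of "[:[:0, 1:]:]" "(1, 0)"] val_u_pos by (simp add: coeff2_def)
qed

lemma val_const: "c \<noteq> 0 \<Longrightarrow> \<nu> (const_fun c) = 0"
  using val_eval2_unit[of "[:[:c:]:]"] by (simp add: coeff2_def)

lemma val_one: "\<nu> 1 = 0"
  using val_const[of 1] by (simp add: const_fun.map_one)

lemma val_inverse: "f \<noteq> 0 \<Longrightarrow> \<nu> (inverse f) = - \<nu> f"
  using val_mult[of f "inverse f"] by (simp add: val_one)

lemma val_divide: "f \<noteq> 0 \<Longrightarrow> g \<noteq> 0 \<Longrightarrow> \<nu> (f / g) = \<nu> f - \<nu> g"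
  by (simp add: divide_inverse val_mult val_inverse)

lemma val_power: "f \<noteq> 0 \<Longrightarrow> \<nu> (f ^ n) = int n * \<nu> f"
  by (induction n) (simp_all add: val_one val_mult algebra_simps)

definition val_ge :: "int \<Rightarrow> 'a plane_function_field \<Rightarrow> bool" where
  "val_ge m f \<longleftrightarrow> f = 0 \<or> m \<le> \<nu> f"

lemma val_ge_0 [simp]: "val_ge m 0"
  by (simp add: val_ge_def)

lemma val_ge_add: "val_ge m f \<Longrightarrow> val_ge m g \<Longrightarrow> val_ge m (f + g)"
  unfolding val_ge_def using val_add[of f g] by fastforce

lemma val_ge_mult: "val_ge m f \<Longrightarrow> val_ge n g \<Longrightarrow> val_ge (m + n) (f * g)"
  by (cases "f = 0 \<or> g = 0") (auto simp: val_ge_def val_mult)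

lemma val_ge_mono: "val_ge n f \<Longrightarrow> m \<le> n \<Longrightarrow> val_ge m f"
  unfolding val_ge_def by auto

lemma val_ge_sum: "(\<And>i. i \<in> A \<Longrightarrow> val_ge m (f i)) \<Longrightarrow> val_ge m (sum f A)"
  by (induction A rule: infinite_finite_induct) (simp_all add: val_ge_add)

abbreviation "\<O> \<equiv> local_ring u v"

lemma local_ringE:
  assumes "f \<in> \<O>"
  obtains a b where "coeff2 b (0, 0) \<noteq> 0" "f = eval2 a u v / eval2 b u v"
  using assms unfolding local_ring_def coeff2_def by auto

lemma local_ringI: "coeff2 b (0, 0) \<noteq> 0 \<Longrightarrow> eval2 a u v / eval2 b u v \<in> \<O>"
  unfolding local_ring_def coeff2_def by auto

lemma eval2_local_ring: "eval2 a u v \<in> \<O>"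
  using local_ringI[of 1 a] by (simp add: eval2.map_one)

lemma local_ring_add: "f \<in> \<O> \<Longrightarrow> g \<in> \<O> \<Longrightarrow> f + g \<in> \<O>"
proof (elim local_ringE)
  fix a b c d assume "coeff2 b (0, 0) \<noteq> 0" "f = eval2 a u v / eval2 b u v"
    "coeff2 d (0, 0) \<noteq> 0" "g = eval2 c u v / eval2 d u v"
  moreover from this have "f + g = eval2 (a * d + c * b) u v / eval2 (b * d) u v"
    using coeff2_00_nonzero[of b] coeff2_00_nonzero[of d]
    by (simp add: eval2.map_add eval2.map_mult add_frac_eq mult.commute)
  ultimately show ?thesis using local_ringI[of "b * d"] by simp
qed

lemma local_ring_mult: "f \<in> \<O> \<Longrightarrow> g \<in> \<O> \<Longrightarrow> f * g \<in> \<O>"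
proof (elim local_ringE)
  fix a b c d assume "coeff2 b (0, 0) \<noteq> 0" "f = eval2 a u v / eval2 b u v"
    "coeff2 d (0, 0) \<noteq> 0" "g = eval2 c u v / eval2 d u v"
  moreover from this have "f * g = eval2 (a * c) u v / eval2 (b * d) u v"
    by (simp add: eval2.map_mult)
  ultimately show ?thesis using local_ringI[of "b * d"] by simp
qed

lemma local_ring_basic: "u \<in> \<O>" "v \<in> \<O>" "1 \<in> \<O>" "0 \<in> \<O>" "const_fun c \<in> \<O>"
  using eval2_local_ring[of "[:[:0, 1:]:]"] eval2_local_ring[of "[:0, 1:]"] eval2_local_ring[of 1]
    eval2_local_ring[of 0] eval2_local_ring[of "[:[:c:]:]"]
  by (simp_all add: eval2.map_one eval2.map_zero)

lemma local_ring_power: "f \<in> \<O> \<Longrightarrow> f ^ n \<in> \<O>"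
  by (induction n) (simp_all add: local_ring_basic local_ring_mult)

lemma local_ring_uminus: "f \<in> \<O> \<Longrightarrow> - f \<in> \<O>"
  using local_ring_mult[OF local_ring_basic(5)[of "- 1"]]
  by (simp add: const_fun.map_uminus const_fun.map_one)

lemma val_fraction:
  assumes "a \<noteq> 0" "coeff2 b (0, 0) \<noteq> 0"
  shows "\<nu> (eval2 a u v / eval2 b u v) = \<nu> (eval2 a u v)"
  using assms coeff2_00_nonzero[OF assms(2)] by (simp add: val_divide val_eval2_unit)

lemma val_local_ring: "f \<in> \<O> \<Longrightarrow> val_ge 0 f"
proof (elim local_ringE)
  fix a b assume *: "coeff2 b (0, 0) \<noteq> 0" "f = eval2 a u v / eval2 b u v"
  have "0 \<le> \<nu> (eval2 a u v)" if "a \<noteq> 0"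
    using val_eval2_unit[of a] val_eval2_pos[OF that] by force
  then show ?thesis
    unfolding val_ge_def using * val_fraction[of a b] by (auto simp: eval2.map_zero)
qed

lemma max_ideal_val:
  assumes "f \<in> max_ideal u v" "f \<noteq> 0"
  shows "min (\<nu> u) (\<nu> v) \<le> \<nu> f"
proof -
  obtain a b where ab: "coeff2 a (0, 0) = 0" "coeff2 b (0, 0) \<noteq> 0" "f = eval2 a u v / eval2 b u v"
    using assms(1) unfolding max_ideal_def coeff2_def by auto
  have "a \<noteq> 0" using assms(2) ab by (auto simp: eval2.map_zero)
  let ?m = "min (\<nu> u) (\<nu> v)"
  have "val_ge ?m (eval2 a u v)"
    unfolding eval2_supp2
  proof (rule val_ge_sum)
    fix p assume p: "p \<in> supp2 a"
    then have "p \<noteq> (0, 0)" using ab(1) by auto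
    then have "1 \<le> int (fst p) + int (snd p)" by (cases p) auto
    then have "?m * 1 \<le> ?m * (int (fst p) + int (snd p))"
      using val_u_pos val_v_pos by (intro mult_left_mono) auto
    also have "\<dots> \<le> \<nu> (const_fun (coeff2 a p) * u ^ fst p * v ^ snd p)"
      using p uv_nonzero
      by (simp add: val_mult val_const val_power distrib_left)
        (metis add_mono min.cobounded1 min.cobounded2 mult.commute mult_left_mono of_nat_0_le_iff)
    finally show "val_ge ?m (const_fun (coeff2 a p) * u ^ fst p * v ^ snd p)"
      by (simp add: val_ge_def)
  qed
  then show ?thesis using \<open>a \<noteq> 0\<close> ab by (simp add: val_ge_def val_fraction)
qed

lemma max_ideal_uv: "u \<in> max_ideal u v" "v \<in> max_ideal u v"
proof -
  have "eval2 h u v \<in> max_ideal u v" if "coeff2 h (0, 0) = 0" for h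
  proof -
    have "eval2 h u v = eval2 h u v / eval2 1 u v" by (simp add: eval2.map_one)
    then show ?thesis
      unfolding max_ideal_def using that coeff2_one unfolding coeff2_def by force
  qed
  from this[of "[:[:0, 1:]:]"] this[of "[:0, 1:]"]
  show "u \<in> max_ideal u v" "v \<in> max_ideal u v" by (simp_all add: coeff2_def)
qed

text \<open>\<open>u\<close> and \<open>v\<close> generate the maximal ideal, so the least value
  exists and is attained at one of them.\<close>

lemma beta0_eq: "beta0 u v \<nu> = min (\<nu> u) (\<nu> v)"
  unfolding beta0_def
proof (rule Least_equality)
  show "\<exists>f\<in>max_ideal u v - {0}. \<nu> f = min (\<nu> u) (\<nu> v)"
    using max_ideal_uv uv_nonzero by (cases "\<nu> u \<le> \<nu> v") (force simp: min_def)+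
  show "min (\<nu> u) (\<nu> v) \<le> k" if "\<exists>f\<in>max_ideal u v - {0}. \<nu> f = k" for k
    using that max_ideal_val by auto
qed

lemma beta0_pos: "0 < beta0 u v \<nu>"
  using beta0_eq val_u_pos val_v_pos by simp

lemma valuation_ideal_eq: "valuation_ideal u v \<nu> m = {h \<in> \<O>. val_ge (int m) h}"
  unfolding valuation_ideal_def val_ge_def using local_ring_basic(4) by auto

text \<open>
  \<^const>\<open>prod_encode\<close> lists the monomials by total degree and is monotone in both exponents, so
  these ideals form a chain whose successive quotients have length one.
\<close>

definition encode_ideal :: "nat \<Rightarrow> 'a plane_function_field set" where
  "encode_ideal s = {eval2 a u v / eval2 b u v | a b. coeff2 b (0, 0) \<noteq> 0 \<and>
     (\<forall>p. prod_encode p < s \<longrightarrow> coeff2 a p = 0)}"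

lemma encode_idealI:
  "coeff2 b (0, 0) \<noteq> 0 \<Longrightarrow> (\<And>p. prod_encode p < s \<Longrightarrow> coeff2 a p = 0) \<Longrightarrow>
   eval2 a u v / eval2 b u v \<in> encode_ideal s"
  unfolding encode_ideal_def by blast

lemma encode_idealE:
  assumes "f \<in> encode_ideal s"
  obtains b a where "coeff2 b (0, 0) \<noteq> 0" "f = eval2 a u v / eval2 b u v"
    "\<forall>p. prod_encode p < s \<longrightarrow> coeff2 a p = 0"
  using assms unfolding encode_ideal_def by auto

lemma encode_ideal_is_ideal: "is_ideal \<O> (encode_ideal s)"
  unfolding is_ideal_def
proof (intro conjI ballI)
  show "encode_ideal s \<subseteq> \<O>"
    unfolding encode_ideal_def using local_ringI by blast
  show "0 \<in> encode_ideal s"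
    using encode_idealI[of 1 s 0] by (simp add: eval2.map_zero eval2.map_one)
  show "f + g \<in> encode_ideal s" if f: "f \<in> encode_ideal s" and g: "g \<in> encode_ideal s" for f g
  proof -
    obtain a b where ab: "coeff2 b (0, 0) \<noteq> 0" "f = eval2 a u v / eval2 b u v"
      "\<forall>p. prod_encode p < s \<longrightarrow> coeff2 a p = 0"
      using f by (rule encode_idealE)
    obtain c d where cd: "coeff2 d (0, 0) \<noteq> 0" "g = eval2 c u v / eval2 d u v"
      "\<forall>p. prod_encode p < s \<longrightarrow> coeff2 c p = 0"
      using g by (rule encode_idealE)
    have "f + g = eval2 (a * d + c * b) u v / eval2 (b * d) u v"
      using ab cd coeff2_00_nonzero[of b] coeff2_00_nonzero[of d]
      by (simp add: eval2.map_add eval2.map_mult add_frac_eq mult.commute)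
    also have "\<dots> \<in> encode_ideal s"
      using ab cd coeff2_mult_encode[of s a] coeff2_mult_encode[of s c] by (intro encode_idealI) auto
    finally show ?thesis .
  qed
  show "r * f \<in> encode_ideal s" if r: "r \<in> \<O>" and f: "f \<in> encode_ideal s" for r f
  proof -
    obtain a b where ab: "coeff2 b (0, 0) \<noteq> 0" "f = eval2 a u v / eval2 b u v"
      "\<forall>p. prod_encode p < s \<longrightarrow> coeff2 a p = 0"
      using f by (rule encode_idealE)
    obtain c d where cd: "coeff2 d (0, 0) \<noteq> 0" "r = eval2 c u v / eval2 d u v"
      using r by (rule local_ringE)
    have "r * f = eval2 (a * c) u v / eval2 (d * b) u v"
      by (simp add: ab cd eval2.map_mult mult.commute)
    also have "\<dots> \<in> encode_ideal s"
      using ab cd coeff2_mult_encode[of s a] by (intro encode_idealI) auto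
    finally show ?thesis .
  qed
qed

lemma encode_ideal_antimono: "s \<le> t \<Longrightarrow> encode_ideal t \<subseteq> encode_ideal s"
  unfolding encode_ideal_def by (blast intro: less_le_trans)

lemma encode_ideal_strict: "encode_ideal (Suc s) \<subset> encode_ideal s"
proof -
  obtain i j where s: "prod_encode (i, j) = s"
    by (metis prod_decode_inverse surj_pair)
  define h :: "'a poly poly" where "h = monom (monom 1 i) j"
  have "eval2 h u v \<in> encode_ideal s"
    using encode_idealI[of 1 s h] s by (force simp: coeff2_monom h_def eval2.map_one)
  moreover have "eval2 h u v \<notin> encode_ideal (Suc s)"
  proof
    assume "eval2 h u v \<in> encode_ideal (Suc s)"
    then obtain a b where ab: "coeff2 b (0, 0) \<noteq> 0" "eval2 h u v = eval2 a u v / eval2 b u v"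
      "\<forall>p. prod_encode p < Suc s \<longrightarrow> coeff2 a p = 0"
      by (rule encode_idealE)
    have "eval2 (h * b) u v = eval2 a u v"
      using ab(2) coeff2_00_nonzero[OF ab(1)] by (simp add: eval2.map_mult)
    then have "h * b = a" by (rule alg_indep_cancel[OF indep])
    \<comment> \<open>Multiplication by the \<open>s\<close>-th monomial shifts the nonzero constant
      term of \<open>b\<close> to position \<open>s\<close>, where membership in
      \<open>encode_ideal (Suc s)\<close> demands a zero.\<close>
    moreover have "coeff2 (h * b) (i, j) = coeff2 b (0, 0)"
      by (simp add: h_def coeff2_def coeff_monom_mult)
    ultimately show False using ab(1) ab(3)[rule_format, of "(i, j)"] s by simp
  qed
  ultimately show ?thesis using encode_ideal_antimono[of s "Suc s"] by auto
qed

text \<open>By the Izumi-type bound a value of at least \<open>m\<close> forces every monomial of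
  the numerator to have degree at least \<open>m div C\<close>. There are \<open>triangle k\<close>
  monomials of degree below \<open>k\<close>, and \<open>prod_encode\<close> lists them
  first.\<close>

lemma valuation_ideal_subset_encode: "valuation_ideal u v \<nu> m \<subseteq> encode_ideal (triangle (m div C))"
proof
  fix f assume "f \<in> valuation_ideal u v \<nu> m"
  then have f: "f \<in> \<O>" "val_ge (int m) f" by (auto simp: valuation_ideal_eq)
  obtain a b where ab: "coeff2 b (0, 0) \<noteq> 0" "f = eval2 a u v / eval2 b u v"
    using f(1) by (rule local_ringE)
  have "coeff2 a p = 0" if p: "prod_encode p < triangle (m div C)" for p
  proof (rule ccontr)
    assume "coeff2 a p \<noteq> 0"
    then have "a \<noteq> 0" by auto
    then have "int m \<le> \<nu> (eval2 a u v)"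
      using f(2) coeff2_00_nonzero[OF ab(1)] ab by (simp add: val_ge_def val_fraction)
    also have "\<dots> \<le> int (C * (fst p + snd p))"
      using val_eval2_le \<open>coeff2 a p \<noteq> 0\<close> by blast
    finally have "m \<le> C * (fst p + snd p)" by (simp only: of_nat_le_iff)
    then have "m div C \<le> C * (fst p + snd p) div C" by (rule div_le_mono)
    then have "m div C \<le> fst p + snd p" using C_pos by simp
    then have "triangle (m div C) \<le> triangle (fst p + snd p)" by (rule triangle_mono)
    also have "\<dots> \<le> prod_encode p" by (cases p) (simp add: prod_encode_def)
    finally show False using p by simp
  qed
  then show "f \<in> encode_ideal (triangle (m div C))"
    unfolding ab(2) using ab(1) by (intro encode_idealI)
qed

lemma quotient_length_ge: "enat (triangle (m div C)) \<le> quotient_length \<O> (valuation_ideal u v \<nu> m)"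
proof -
  let ?n = "triangle (m div C)"
  have "valuation_ideal u v \<nu> m \<subseteq> encode_ideal (?n - i)" for i
    using valuation_ideal_subset_encode encode_ideal_antimono[of "?n - i" ?n] by force
  moreover have "encode_ideal (?n - i) \<subset> encode_ideal (?n - Suc i)" if "i < ?n" for i
    using encode_ideal_strict[of "?n - Suc i"] that by (simp add: Suc_diff_Suc)
  \<comment> \<open>The ideals \<open>encode_ideal s\<close> decrease in \<open>s\<close>, while
    \<open>quotient_length\<close> counts increasing chains; hence the reversed index.\<close>
  ultimately have "\<exists>J. (\<forall>i\<le>?n. is_ideal \<O> (J i) \<and> valuation_ideal u v \<nu> m \<subseteq> J i) \<and> (\<forall>i<?n. J i \<subset> J (Suc i))"
    using encode_ideal_is_ideal by (intro exI[of _ "\<lambda>i. encode_ideal (?n - i)"]) simp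
  then show ?thesis
    unfolding quotient_length_def by (intro Sup_upper) blast
qed

end

section \<open>Volume and intersection numbers\<close>

interpretation scalars: vector_space "\<lambda>(c :: 'a::field) (f :: 'a plane_function_field). const_fun c * f"
  by unfold_locales (simp_all add: const_fun.map_add const_fun.map_mult const_fun.map_one algebra_simps)

lemma eval2_pCons: "eval2 (pCons q h) x y = eval2 [:q:] x y + y * eval2 h x y"
  by (simp add: eval2_def map_poly_pCons const_fun.map_zero)

lemma eval2_pCons_const: "eval2 [:pCons c q:] x y = const_fun c + x * eval2 [:q:] x y"
  by (simp add: eval2_def map_poly_pCons const_fun.map_zero)

lemma ideal_uminus:
  assumes "is_ideal R I" "f \<in> I" "- 1 \<in> R"
  shows "- f \<in> I"
  using assms unfolding is_ideal_def by (metis mult_minus1)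

lemma ideal_subspace:
  assumes "is_ideal R I" "range const_fun \<subseteq> R"
  shows "scalars.subspace I"
  using assms unfolding is_ideal_def by (intro scalars.subspaceI) blast+

text \<open>All members of a chain contain \<open>I\<close>, so a new element at each strict
  inclusion can be corrected by an element of \<open>I\<close> to lie in the span of
  \<open>B\<close>. These choices are linearly independent, each lying outside an ideal, hence a
  subspace, that contains the previous ones.\<close>

lemma quotient_length_le_card:
  fixes R :: "'a::field plane_function_field set"
  assumes const: "range const_fun \<subseteq> R"
    and B: "finite B" "\<And>f. f \<in> R \<Longrightarrow> \<exists>g\<in>I. \<exists>s\<in>scalars.span B. f = g + s"
  shows "quotient_length R I \<le> enat (card B)"
  unfolding quotient_length_def
proof (rule Sup_least)
  fix z assume "z \<in> {enat n | n. \<exists>J :: nat \<Rightarrow> 'a plane_function_field set.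
            (\<forall>i\<le>n. is_ideal R (J i) \<and> I \<subseteq> J i) \<and> (\<forall>i<n. J i \<subset> J (Suc i))}"
  then obtain n and J :: "nat \<Rightarrow> 'a plane_function_field set" where z: "z = enat n"
    and J: "\<And>i. i \<le> n \<Longrightarrow> is_ideal R (J i)" "\<And>i. i \<le> n \<Longrightarrow> I \<subseteq> J i"
    and strict: "\<And>i. i < n \<Longrightarrow> J i \<subset> J (Suc i)"
    by blast
  have "- const_fun (1 :: 'a) \<in> R"
    using const const_fun.map_uminus[of "1 :: 'a"] by (metis rangeI subsetD)
  then have neg: "- 1 \<in> R" by (simp add: const_fun.map_one)
  have ideal_add: "f + g \<in> J i" if "i \<le> n" "f \<in> J i" "g \<in> J i" for f g i
    using J(1)[OF that(1)] that unfolding is_ideal_def by blast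
  have "\<exists>b. b \<in> scalars.span B \<and> b \<in> J (Suc i) \<and> b \<notin> J i" if i: "i < n" for i
  proof -
    obtain e where e: "e \<in> J (Suc i)" "e \<notin> J i" using strict[OF i] by blast
    have "e \<in> R" using J(1)[of "Suc i"] i e(1) unfolding is_ideal_def by auto
    then obtain g b where g: "g \<in> I" "b \<in> scalars.span B" "e = g + b" using B(2) by blast
    have gJ: "g \<in> J i" "g \<in> J (Suc i)" using g(1) J(2)[of i] J(2)[of "Suc i"] i by auto
    have "b \<notin> J i" using ideal_add[of i g b] gJ(1) e(2) g(3) i by auto
    moreover have "- g \<in> J (Suc i)" using ideal_uminus[OF J(1) gJ(2) neg] i by simp
    then have "b \<in> J (Suc i)" using ideal_add[of "Suc i" e "- g"] e(1) g(3) i by simp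
    ultimately show ?thesis using g(2) by blast
  qed
  then obtain b where b: "\<And>i. i < n \<Longrightarrow> b i \<in> scalars.span B \<and> b i \<in> J (Suc i) \<and> b i \<notin> J i"
    by metis
  have "scalars.independent (b ` {..<k}) \<and> card (b ` {..<k}) = k \<and> b ` {..<k} \<subseteq> J k" if "k \<le> n" for k
    using that
  proof (induction k)
    case 0
    then show ?case by (simp add: scalars.independent_empty)
  next
    case (Suc k)
    then have IH: "scalars.independent (b ` {..<k})" "card (b ` {..<k}) = k" "b ` {..<k} \<subseteq> J k"
      and k: "k < n" by auto
    have "scalars.subspace (J k)" using ideal_subspace[OF J(1) const, of k] k by simp
    then have "scalars.span (b ` {..<k}) \<subseteq> J k" using IH(3) by (intro scalars.span_minimal)
    then have "b k \<notin> scalars.span (b ` {..<k})" using b[OF k] by blast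
    moreover from this have "b k \<notin> b ` {..<k}" using scalars.span_superset[of "b ` {..<k}"] by blast
    moreover have "insert (b k) (b ` {..<k}) \<subseteq> J (Suc k)" using b[OF k] IH(3) strict[OF k] by blast
    ultimately show ?case
      using IH by (simp add: lessThan_Suc scalars.independent_insert)
  qed
  then have "scalars.independent (b ` {..<n})" "card (b ` {..<n}) = n" by auto
  moreover have "b ` {..<n} \<subseteq> scalars.span B" using b by blast
  ultimately show "z \<le> enat (card B)"
    using scalars.independent_span_bound[OF B(1)] z by force
qed

section \<open>Lattice points and bounds on the volume\<close>

lemma two_ereal: "y \<noteq> 0 \<Longrightarrow> 2 * ereal x / ereal y = ereal (2 * x / y)"
  unfolding numeral_eq_ereal by simp

text \<open>The main term is the area of the triangle with legs m/\<alpha> and m/\<beta>, counted by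
  columns; the other terms are at most linear in m and disappear in the volume.\<close>

lemma card_triangle_le:
  fixes \<alpha> \<beta> m :: nat
  assumes "0 < \<alpha>" "0 < \<beta>"
  shows "finite {p. fst p * \<alpha> + snd p * \<beta> < m}" (is "finite ?T")
    and "real (card {p. fst p * \<alpha> + snd p * \<beta> < m}) \<le>
      (real m + real \<alpha> / 2)\<^sup>2 / (2 * real \<alpha> * real \<beta>) + real m / real \<alpha> + 1"
proof -
  define A where "A = m div \<alpha>"
  let ?S = "Sigma {..A} (\<lambda>a. {..(m - a * \<alpha>) div \<beta>})"
  have sub: "?T \<subseteq> ?S"
  proof (clarsimp, intro conjI)
    fix a b assume *: "a * \<alpha> + b * \<beta> < m"
    show "a \<le> A" unfolding A_def using * assms(1) by (simp add: less_eq_div_iff_mult_less_eq)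
    show "b \<le> (m - a * \<alpha>) div \<beta>" using * assms(2) by (simp add: less_eq_div_iff_mult_less_eq)
  qed
  then show "finite ?T" by (rule finite_subset) simp
  have "A * \<alpha> \<le> m" unfolding A_def by simp
  have "real (card ?T) \<le> real (card ?S)"
    using sub by (intro of_nat_mono card_mono) auto
  also have "\<dots> = (\<Sum>a\<le>A. real ((m - a * \<alpha>) div \<beta> + 1))"
    by (simp add: card_SigmaI)
  also have "\<dots> \<le> (\<Sum>a\<le>A. (real m - real a * real \<alpha>) / real \<beta> + 1)"
  proof (rule sum_mono)
    fix a assume "a \<in> {..A}"
    then have "a * \<alpha> \<le> m" using \<open>A * \<alpha> \<le> m\<close> by (meson atMost_iff le_trans mult_le_mono1)
    have "real ((m - a * \<alpha>) div \<beta>) \<le> real (m - a * \<alpha>) / real \<beta>"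
      by (rule of_nat_div_le_of_nat)
    then show "real ((m - a * \<alpha>) div \<beta> + 1) \<le> (real m - real a * real \<alpha>) / real \<beta> + 1"
      using \<open>a * \<alpha> \<le> m\<close> by (simp add: of_nat_diff)
  qed
  also have "\<dots> = (\<Sum>a\<le>A. real m - real a * real \<alpha>) / real \<beta> + (real A + 1)"
    by (simp add: sum.distrib sum_divide_distrib)
  also have "(\<Sum>a\<le>A. real m - real a * real \<alpha>) = (real A + 1) * (real m - real \<alpha> * real A / 2)"
    by (induction A) (simp_all add: field_simps)
  \<comment> \<open>The left side is a concave quadratic in \<open>A + 1\<close>; completing the
    square bounds it by its maximum over the reals.\<close>
  also have "(real A + 1) * (real m - real \<alpha> * real A / 2) \<le> (real m + real \<alpha> / 2)\<^sup>2 / (2 * real \<alpha>)"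
  proof -
    have "0 \<le> (real \<alpha> * (real A + 1) - (real m + real \<alpha> / 2))\<^sup>2" by simp
    then have "2 * real \<alpha> * ((real A + 1) * (real m - real \<alpha> * real A / 2)) \<le> (real m + real \<alpha> / 2)\<^sup>2"
      by (simp add: power2_eq_square algebra_simps add_divide_distrib)
    then show ?thesis using assms by (simp add: field_simps)
  qed
  also have "real A \<le> real m / real \<alpha>"
    unfolding A_def by (rule of_nat_div_le_of_nat)
  finally show "real (card ?T) \<le> (real m + real \<alpha> / 2)\<^sup>2 / (2 * real \<alpha> * real \<beta>) + real m / real \<alpha> + 1"
    using assms by (simp add: divide_right_mono)
qed

context plane_valuation
begin

text \<open>The constant is the value of \<open>g\<close> at the centre. After subtracting it the
  numerator has no constant term and splits into a multiple of \<open>u\<close> and a multiple of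
  \<open>v\<close>.\<close>

lemma local_ring_decompose:
  assumes "g \<in> \<O>"
  obtains c x y where "x \<in> \<O>" "y \<in> \<O>" "g = const_fun c + u * x + v * y"
proof -
  obtain a b where ab: "coeff2 b (0, 0) \<noteq> 0" "g = eval2 a u v / eval2 b u v"
    using assms by (rule local_ringE)
  define c where "c = coeff2 a (0, 0) / coeff2 b (0, 0)"
  define N where "N = a - [:[:c:]:] * b"
  obtain q N2 where N2: "N = pCons q N2" by (cases N)
  obtain c' q' where q': "q = pCons c' q'" by (cases q)
  have "coeff2 N (0, 0) = 0"
    using ab(1) by (simp add: N_def c_def coeff2_def)
  then have "c' = 0" by (simp add: N2 q' coeff2_def)
  then have N: "eval2 N u v = u * eval2 [:q':] u v + v * eval2 N2 u v"
    unfolding N2 q' eval2_pCons[of _ N2] eval2_pCons_const by (simp add: const_fun.map_zero)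
  have "eval2 a u v = const_fun c * eval2 b u v + eval2 N u v"
    unfolding N_def eval2.map_diff eval2.map_mult by simp
  then have "g = const_fun c + u * (eval2 [:q':] u v / eval2 b u v) + v * (eval2 N2 u v / eval2 b u v)"
    using coeff2_00_nonzero[OF ab(1)] by (simp add: ab(2) N field_simps)
  then show thesis using that local_ringI[OF ab(1)] by blast
qed

lemma const_local_ring: "range const_fun \<subseteq> \<O>"
  using local_ring_basic(5) by blast

text \<open>
  \<open>\<O>\<close> is spanned over the constants by the \<open>f\<^sup>a l\<^sup>b w\<^sup>i\<close> with \<open>i < k\<close>, modulo such products with large
  \<open>a \<alpha> + b \<beta>\<close>, which lie in the valuation ideal.
\<close>

lemma quotient_length_valuation_ideal_le:
  assumes O: "f \<in> \<O>" "l \<in> \<O>" "w \<in> \<O>"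
    and \<alpha>: "f \<noteq> 0" "\<nu> f = int \<alpha>" "0 < \<alpha>" and \<beta>: "l \<noteq> 0" "\<nu> l = int \<beta>" "0 < \<beta>"
    and u: "u = const_fun a1 * l + const_fun b1 * w" and v: "v = const_fun a2 * l + const_fun b2 * w"
    and wk: "w ^ k = r1 * f + r2 * l" "r1 \<in> \<O>" "r2 \<in> \<O>"
  shows "quotient_length \<O> (valuation_ideal u v \<nu> m) \<le> enat (k * card {p. fst p * \<alpha> + snd p * \<beta> < m})"
proof -
  let ?T = "{p. fst p * \<alpha> + snd p * \<beta> < m}"
  let ?b = "\<lambda>(p, i). f ^ fst p * l ^ snd p * w ^ i"
  define B where "B = ?b ` (?T \<times> {..<k})"
  have finT: "finite ?T" using card_triangle_le(1)[OF \<alpha>(3) \<beta>(3)] .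
  have "finite B" unfolding B_def using finT by simp
  \<comment> \<open>Modulo \<open>l\<close> the maximal ideal is generated by \<open>w\<close>
    alone, because \<open>u\<close> and \<open>v\<close> are combinations of \<open>l\<close> and
    \<open>w\<close>. Repeatedly splitting off values at the centre expands \<open>g\<close> in
    powers of \<open>w\<close>.\<close>
  have reduce: "\<exists>s\<in>scalars.span ((\<lambda>i. w ^ i) ` {..<n}). \<exists>x\<in>\<O>. \<exists>y\<in>\<O>. g = s + w ^ n * x + l * y"
    if "g \<in> \<O>" for g n
  proof (induction n)
    case 0
    have "g = 0 + w ^ 0 * g + l * 0" by simp
    then show ?case using that local_ring_basic(4) scalars.span_zero by blast
  next
    case (Suc n)
    then obtain s x y where s: "s \<in> scalars.span ((\<lambda>i. w ^ i) ` {..<n})" "x \<in> \<O>" "y \<in> \<O>"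
      "g = s + w ^ n * x + l * y" by blast
    obtain c x' y' where x': "x' \<in> \<O>" "y' \<in> \<O>" "x = const_fun c + u * x' + v * y'"
      using s(2) by (rule local_ring_decompose)
    let ?s = "s + const_fun c * w ^ n"
    let ?x = "const_fun b1 * x' + const_fun b2 * y'"
    let ?y = "y + w ^ n * (const_fun a1 * x' + const_fun a2 * y')"
    have "g = ?s + w ^ Suc n * ?x + l * ?y"
      unfolding s(4) x'(3) by (simp add: u[symmetric] v[symmetric]) (simp add: u v algebra_simps)
    moreover have "?s \<in> scalars.span ((\<lambda>i. w ^ i) ` {..<Suc n})"
    proof (rule scalars.span_add)
      show "s \<in> scalars.span ((\<lambda>i. w ^ i) ` {..<Suc n})"
        by (rule subsetD[OF scalars.span_mono s(1)]) auto
      show "const_fun c * w ^ n \<in> scalars.span ((\<lambda>i. w ^ i) ` {..<Suc n})"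
        by (intro scalars.span_scale scalars.span_base) auto
    qed
    moreover have "?x \<in> \<O>" "?y \<in> \<O>"
      using s x' O(3) by (auto intro!: local_ring_add local_ring_mult local_ring_power local_ring_basic(5))
    ultimately show ?case by blast
  qed
  define G where "G = {g + s | g s. g \<in> valuation_ideal u v \<nu> m \<and> s \<in> scalars.span B}"
  have GI: "g + s \<in> G" if "g \<in> valuation_ideal u v \<nu> m" "s \<in> scalars.span B" for g s
    using that unfolding G_def by blast
  have zero: "0 \<in> valuation_ideal u v \<nu> m" by (simp add: valuation_ideal_def)
  have G_add: "x + y \<in> G" if x: "x \<in> G" and y: "y \<in> G" for x y
  proof -
    obtain g s g' s' where *: "g \<in> valuation_ideal u v \<nu> m" "s \<in> scalars.span B" "x = g + s"
      "g' \<in> valuation_ideal u v \<nu> m" "s' \<in> scalars.span B" "y = g' + s'"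
      using x y unfolding G_def by blast
    have "g + g' \<in> valuation_ideal u v \<nu> m"
      using * by (simp add: valuation_ideal_eq val_ge_add local_ring_add)
    then have "(g + g') + (s + s') \<in> G" using * by (intro GI scalars.span_add)
    then show ?thesis by (simp add: * add_ac)
  qed
  \<comment> \<open>Here \<open>n\<close> bounds the amount by which the guaranteed value
    \<open>a * \<alpha> + b * \<beta>\<close> falls short of \<open>m\<close>. While it does,
    \<open>g\<close> is expanded in powers of \<open>w\<close>: terms below \<open>w ^ k\<close>
    land in the span of \<open>B\<close>, and the rest gains a factor \<open>f\<close> or
    \<open>l\<close> by \<open>wk\<close>, which lowers the deficit since \<alpha> and \<beta> are
    positive.\<close>
  have "f ^ a * l ^ b * g \<in> G" if "m \<le> a * \<alpha> + b * \<beta> + n" "g \<in> \<O>" for a b n g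
    using that
  proof (induction n arbitrary: a b g)
    case 0
    have "val_ge (int (a * \<alpha> + b * \<beta>) + 0) (f ^ a * l ^ b * g)"
    proof (rule val_ge_mult)
      show "val_ge (int (a * \<alpha> + b * \<beta>)) (f ^ a * l ^ b)"
        using \<alpha> \<beta> by (simp add: val_ge_def val_mult val_power)
      show "val_ge 0 g" using 0 val_local_ring by blast
    qed
    then have "val_ge (int m) (f ^ a * l ^ b * g)"
      by (rule val_ge_mono) (use 0 in linarith)
    then have "f ^ a * l ^ b * g \<in> valuation_ideal u v \<nu> m"
      using 0 O by (simp add: valuation_ideal_eq local_ring_mult local_ring_power)
    then show ?case using GI[OF _ scalars.span_zero] by (simp only: add_0_right)
  next
    case (Suc n)
    show ?case
    proof (cases "m \<le> a * \<alpha> + b * \<beta> + n")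
      case True
      then show ?thesis using Suc by blast
    next
      case False
      obtain s x y where s: "s \<in> scalars.span ((\<lambda>i. w ^ i) ` {..<k})" "x \<in> \<O>" "y \<in> \<O>"
        "g = s + w ^ k * x + l * y" using reduce[OF Suc.prems(2), of k] by blast
      let ?V = "{s. f ^ a * l ^ b * s \<in> scalars.span B}"
      have "scalars.subspace ?V"
        by (intro scalars.subspaceI)
          (auto simp: distrib_left scalars.span_add scalars.span_zero
            mult.left_commute[of _ "const_fun _"] intro: scalars.span_scale)
      moreover have "(\<lambda>i. w ^ i) ` {..<k} \<subseteq> ?V"
      proof clarify
        fix i assume "i < k"
        then have "((a, b), i) \<in> ?T \<times> {..<k}" using False by simp
        then have "?b ((a, b), i) \<in> B" unfolding B_def by (rule imageI)
        then show "f ^ a * l ^ b * w ^ i \<in> scalars.span B" by (simp add: scalars.span_base)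
      qed
      ultimately have "f ^ a * l ^ b * s \<in> scalars.span B"
        using scalars.span_minimal[of "(\<lambda>i. w ^ i) ` {..<k}" ?V] s(1) by blast
      then have 1: "f ^ a * l ^ b * s \<in> G" using GI[OF zero] by (simp only: add_0_left)
      have 2: "f ^ Suc a * l ^ b * (r1 * x) \<in> G"
        using False Suc.prems \<alpha>(3) s wk by (intro Suc.IH local_ring_mult) auto
      have 3: "f ^ a * l ^ Suc b * (r2 * x + y) \<in> G"
        using False Suc.prems \<beta>(3) s wk by (intro Suc.IH local_ring_add local_ring_mult) auto
      have "f ^ a * l ^ b * g = f ^ a * l ^ b * s + (f ^ Suc a * l ^ b * (r1 * x) + f ^ a * l ^ Suc b * (r2 * x + y))"
        unfolding s(4) wk(1) by (simp add: algebra_simps)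
      then show ?thesis using G_add[OF 1 G_add[OF 2 3]] by simp
    qed
  qed
  from this[of 0 0 m] have "g \<in> G" if "g \<in> \<O>" for g using that by simp
  then have "\<exists>x\<in>valuation_ideal u v \<nu> m. \<exists>s\<in>scalars.span B. g = x + s" if "g \<in> \<O>" for g
    using that unfolding G_def by blast
  then have "quotient_length \<O> (valuation_ideal u v \<nu> m) \<le> enat (card B)"
    by (rule quotient_length_le_card[OF const_local_ring \<open>finite B\<close>])
  also have "card B \<le> k * card ?T"
    unfolding B_def using card_image_le[of "?T \<times> {..<k}" ?b] finT
    by (simp add: card_cartesian_product mult.commute)
  finally show ?thesis by simp
qed

text \<open>The relation for \<open>w ^ k\<close> says that \<open>f\<close> and \<open>l\<close>
  meet at the centre with multiplicity at most \<open>k\<close>. The lattice count bounds the volume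
  above and thereby keeps the limsup finite; for an infinite one \<open>real_of_ereal\<close> would
  return 0. Positivity comes from \<open>quotient_length_ge\<close>.\<close>

lemma vol_bounds:
  assumes "f \<in> \<O>" "l \<in> \<O>" "w \<in> \<O>"
    and "f \<noteq> 0" "0 < \<nu> f" "l \<noteq> 0" "0 < \<nu> l"
    and "u = const_fun a1 * l + const_fun b1 * w" "v = const_fun a2 * l + const_fun b2 * w"
    and "w ^ k = r1 * f + r2 * l" "r1 \<in> \<O>" "r2 \<in> \<O>"
  shows "0 < vol u v \<nu>" "vol u v \<nu> * (\<nu> f * \<nu> l) \<le> real k"
proof -
  obtain \<alpha> \<beta> where \<alpha>: "\<nu> f = int \<alpha>" "0 < \<alpha>" and \<beta>: "\<nu> l = int \<beta>" "0 < \<beta>"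
    using assms(5,7) by (metis zero_less_imp_eq_int)
  define Q where "Q m = quotient_length \<O> (valuation_ideal u v \<nu> m)" for m
  define s where "s m = 2 * ereal_of_enat (Q m) / ereal (real m ^ 2)" for m
  have le: "Q m \<le> enat (k * card {p. fst p * \<alpha> + snd p * \<beta> < m})" for m
    unfolding Q_def using assms \<alpha> \<beta> by (intro quotient_length_valuation_ideal_le)
  have ge: "enat (triangle (m div C)) \<le> Q m" for m
    unfolding Q_def by (rule quotient_length_ge)
  define h where "h m = 2 * (real k * ((real m + real \<alpha> / 2)\<^sup>2 / (2 * real \<alpha> * real \<beta>) + real m / real \<alpha> + 1)) / real m ^ 2" for m :: nat
  have s_le: "s m \<le> ereal (h m)" if m: "0 < m" for m
  proof -
    obtain j where j: "Q m = enat j" "j \<le> k * card {p. fst p * \<alpha> + snd p * \<beta> < m}"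
      using le[of m] by (cases "Q m") auto
    have "real j \<le> real k * real (card {p. fst p * \<alpha> + snd p * \<beta> < m})"
      using j(2) by (metis of_nat_le_iff of_nat_mult)
    also have "\<dots> \<le> real k * ((real m + real \<alpha> / 2)\<^sup>2 / (2 * real \<alpha> * real \<beta>) + real m / real \<alpha> + 1)"
      using card_triangle_le(2)[OF \<alpha>(2) \<beta>(2)] by (intro mult_left_mono) auto
    finally have "2 * real j / real m ^ 2 \<le> h m"
      unfolding h_def by (intro divide_right_mono mult_left_mono) auto
    then show ?thesis using m by (simp add: s_def j two_ereal)
  qed
  have "h \<longlonglongrightarrow> real k / (real \<alpha> * real \<beta>)"
    unfolding h_def using \<alpha>(2) \<beta>(2) by real_asymp (simp add: divide_inverse)
  then have "limsup (\<lambda>m. ereal (h m)) = ereal (real k / (real \<alpha> * real \<beta>))"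
    by (intro lim_imp_Limsup) (auto intro: tendsto_ereal)
  moreover have "limsup s \<le> limsup (\<lambda>m. ereal (h m))"
    by (rule Limsup_mono) (auto intro!: eventually_mono[OF eventually_gt_at_top[of 0]] s_le)
  ultimately have upper: "limsup s \<le> ereal (real k / (real \<alpha> * real \<beta>))" by simp
  \<comment> \<open>With r = m div C, the condition \<open>2 * C \<le> m\<close> gives m \<le> 2Cr,
    so the length, being at least \<open>triangle r\<close>, is at least m^2 / (8 C^2); doubling and
    dividing by m^2 yields the constant.\<close>
  have lower: "ereal (1 / (4 * real C ^ 2)) \<le> limsup s"
  proof (rule le_Limsup)
    show "\<forall>\<^sub>F m in sequentially. ereal (1 / (4 * real C ^ 2)) \<le> s m"
    proof (rule eventually_mono[OF eventually_ge_at_top[of "2 * C"]])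
      fix m assume m: "2 * C \<le> m"
      then have "0 < m" using C_pos by auto
      obtain j where j: "Q m = enat j" using le[of m] by (cases "Q m") auto
      let ?r = "m div C"
      have "2 * triangle ?r = ?r * Suc ?r" by (simp add: triangle_def)
      then have tri: "real ?r * (real ?r + 1) \<le> 2 * real j"
        using ge[of m] j by (metis Suc_eq_plus1 enat_ord_simps(1) mult_le_mono2 of_nat_1 of_nat_add of_nat_le_iff of_nat_mult of_nat_numeral)
      have "m < C * ?r + C" using C_pos dividend_less_times_div[of C m] by simp
      then have "real m \<le> real C * real ?r + real C"
        by (metis less_imp_le of_nat_add of_nat_le_iff of_nat_mult)
      then have "real m \<le> 2 * (real C * real ?r)" using m by linarith
      then have "real m ^ 2 \<le> (2 * (real C * real ?r)) ^ 2" by (intro power_mono) auto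
      also have "\<dots> = 4 * real C ^ 2 * (real ?r * real ?r)" by (simp add: power2_eq_square)
      also have "\<dots> \<le> 4 * real C ^ 2 * (2 * real j)"
        using tri by (intro mult_left_mono) (auto simp: algebra_simps)
      finally have "1 / (4 * real C ^ 2) \<le> 2 * real j / real m ^ 2"
        using C_pos \<open>0 < m\<close> by (simp add: field_simps)
      then show "ereal (1 / (4 * real C ^ 2)) \<le> s m"
        using \<open>0 < m\<close> by (simp add: s_def j two_ereal)
    qed
  qed simp
  have vol: "vol u v \<nu> = real_of_ereal (limsup s)"
    unfolding vol_def s_def Q_def ..
  obtain L where L: "limsup s = ereal L"
    using upper lower by (cases "limsup s") auto
  have "0 < 1 / (4 * real C ^ 2)" using C_pos by simp
  then show "0 < vol u v \<nu>" using lower unfolding vol L ereal_less_eq real_of_ereal.simps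
    by (rule less_le_trans)
  have "L \<le> real k / (real \<alpha> * real \<beta>)" using upper by (simp add: L)
  then show "vol u v \<nu> * (\<nu> f * \<nu> l) \<le> real k"
    using \<alpha> \<beta> by (simp add: vol L field_simps)
qed

end

section \<open>Degrees, the m-adic valuation and the Seshadri-type constant\<close>

text \<open>Fekete's lemma; without it \<^const>\<open>mu_hat\<close> could be the junk value of \<^const>\<open>lim\<close>.\<close>

lemma superadditive_convergent:
  fixes a :: "nat \<Rightarrow> real"
  assumes super: "\<And>m n. a m + a n \<le> a (m + n)"
    and nonneg: "\<And>n. 0 \<le> a n" and bound: "\<And>n. a n \<le> K * real n"
  shows "convergent (\<lambda>n. a n / real n)"
proof -
  define L where "L = (SUP n\<in>{1..}. a n / real n)"
  have bdd: "bdd_above ((\<lambda>n. a n / real n) ` {1..})"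
    using bound by (intro bdd_aboveI[of _ K]) (auto simp: field_simps)
  have mult: "real q * a n \<le> a (q * n)" for q n
  proof (induction q)
    case (Suc q)
    then show ?case using super[of n "q * n"] by (simp add: algebra_simps)
  qed (use nonneg in simp)
  have "(\<lambda>n. a n / real n) \<longlonglongrightarrow> L"
  proof (rule order_tendstoI)
    fix z assume "L < z"
    show "\<forall>\<^sub>F n in sequentially. a n / real n < z"
      using eventually_ge_at_top[of 1]
    proof eventually_elim
      case (elim n)
      then have "a n / real n \<le> L" unfolding L_def using bdd by (intro cSUP_upper) auto
      then show ?case using \<open>L < z\<close> by simp
    qed
  next
    fix z assume "z < L"
    then obtain n where n: "1 \<le> n" "z < a n / real n"
      unfolding L_def using less_cSUP_iff[OF _ bdd, of z] by force
    have "(\<lambda>N. (1 - real n / real N) * (a n / real n)) \<longlonglongrightarrow> (1 - 0) * (a n / real n)"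
      by (intro tendsto_intros lim_const_over_n)
    then have "\<forall>\<^sub>F N in sequentially. z < (1 - real n / real N) * (a n / real n)"
      using n(2) by (auto dest: order_tendstoD(1))
    then show "\<forall>\<^sub>F N in sequentially. z < a N / real N"
      using eventually_ge_at_top[of 1]
    proof eventually_elim
      case (elim N)
      \<comment> \<open>Superadditivity compares \<open>a N\<close> with \<open>N div n\<close>
        copies of \<open>a n\<close>; discarding the remainder costs less than one block, which
        explains the factor \<open>1 - n / N\<close>.\<close>
      have N: "N = N div n * n + N mod n" by simp
      have "real N \<le> real (N div n) * real n + real n"
        using mod_less_divisor[of n N] n(1) N
        by (metis add_left_mono less_imp_le of_nat_add of_nat_le_iff of_nat_mult less_eq_Suc_le One_nat_def)
      then have "(real N - real n) * (a n / real n) \<le> real (N div n) * real n * (a n / real n)"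
        using nonneg[of n] by (intro mult_right_mono) auto
      also have "\<dots> = real (N div n) * a n" using n(1) by simp
      also have "\<dots> \<le> a (N div n * n)" by (rule mult)
      also have "\<dots> \<le> a N"
        using super[of "N div n * n" "N mod n"] nonneg[of "N mod n"] by simp
      finally have "(real N - real n) * (a n / real n) / real N \<le> a N / real N"
        by (rule divide_right_mono) simp
      moreover have "1 - real n / real N = (real N - real n) / real N"
        using elim by (simp add: diff_divide_distrib)
      ultimately have "(1 - real n / real N) * (a n / real n) \<le> a N / real N"
        by (simp add: mult.commute)
      then show ?case using elim by linarith
    qed
  qed
  then show ?thesis by (rule convergentI)
qed

section \<open>Total degree of bivariate polynomials\<close>

lemma total_degree_le_coeff2: "total_degree_le h d \<longleftrightarrow> (\<forall>p. coeff2 h p \<noteq> 0 \<longrightarrow> fst p + snd p \<le> d)"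
  by (auto simp: total_degree_le_def coeff2_def)

text \<open>The bound is strict so that only 0 qualifies at \<open>d = 0\<close>: the quotient of a
  constant by a linear form then fits the same statement as in higher degree.\<close>

definition degree_less :: "'a::field poly poly \<Rightarrow> nat \<Rightarrow> bool" where
  "degree_less h d \<longleftrightarrow> (\<forall>p. d \<le> fst p + snd p \<longrightarrow> coeff2 h p = 0)"

lemma total_degree_le_iff_less: "total_degree_le h d \<longleftrightarrow> degree_less h (Suc d)"
  by (auto simp: total_degree_le_coeff2 degree_less_def not_less_eq_eq[symmetric])

lemma degree_less_0 [simp]: "degree_less 0 d"
  by (simp add: degree_less_def)

lemma degree_less_0_iff [simp]: "degree_less h 0 \<longleftrightarrow> h = 0"
  using coeff2_nonzero[of h] by (auto simp: degree_less_def)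

lemma degree_less_add: "degree_less f d \<Longrightarrow> degree_less g d \<Longrightarrow> degree_less (f + g) d"
  by (simp add: degree_less_def)

lemma degree_less_mono: "degree_less f d \<Longrightarrow> d \<le> e \<Longrightarrow> degree_less f e"
  by (auto simp: degree_less_def)

lemma coeff2_mult_eq_0:
  assumes "\<And>i' j'. i' \<le> i \<Longrightarrow> j' \<le> j \<Longrightarrow> coeff2 f (i', j') * coeff2 g (i - i', j - j') = 0"
  shows "coeff2 (f * g) (i, j) = 0"
  unfolding coeff2_mult using assms by (intro sum.neutral ballI) simp

lemma degree_less_mult:
  assumes "degree_less f d" "degree_less g (Suc e)"
  shows "degree_less (f * g) (d + e)"
  unfolding degree_less_def
proof (intro allI impI)
  fix p :: "nat \<times> nat" assume p: "d + e \<le> fst p + snd p"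
  have "coeff2 f (i', j') * coeff2 g (fst p - i', snd p - j') = 0" if "i' \<le> fst p" "j' \<le> snd p" for i' j'
  proof (cases "d \<le> i' + j'")
    case True
    then show ?thesis using assms(1) by (simp add: degree_less_def)
  next
    case False
    then have "Suc e \<le> fst p - i' + (snd p - j')" using p that by linarith
    then show ?thesis using assms(2) by (simp add: degree_less_def)
  qed
  then show "coeff2 (f * g) p = 0"
    using coeff2_mult_eq_0[of "fst p" "snd p" f g] by simp
qed

lemma degree_less_const: "degree_less [:[:c:]:] (Suc d)"
  by (auto simp: degree_less_def coeff2_def coeff_pCons split: nat.splits)

lemma degree_less_linear: "degree_less [:[:c, d:], [:e:]:] (Suc (Suc 0))"
  by (auto simp: degree_less_def coeff2_def coeff_pCons split: nat.splits)

section \<open>Powers of the maximal ideal and orders of vanishing\<close>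

lemma coeff2_mult_lowest:
  assumes "\<And>i' j'. i' \<le> i \<Longrightarrow> j' \<le> j \<Longrightarrow> (i', j') \<noteq> (i, j) \<Longrightarrow> coeff2 f (i', j') = 0"
  shows "coeff2 (f * g) (i, j) = coeff2 f (i, j) * coeff2 g (0, 0)"
proof -
  have "coeff2 (f * g) (i, j) = (\<Sum>j'\<le>j. \<Sum>i'\<le>i. if i' = i then (if j' = j then coeff2 f (i, j) * coeff2 g (0, 0) else 0) else 0)"
    unfolding coeff2_mult using assms by (intro sum.cong) auto
  then show ?thesis by (simp add: sum.delta)
qed

lemma prod_encode_less_triangle: "prod_encode p < triangle k \<longleftrightarrow> fst p + snd p < k"
proof -
  obtain i j where p: "p = (i, j)" by (cases p)
  show ?thesis
  proof
    assume "prod_encode p < triangle k"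
    then have "triangle (i + j) < triangle k" by (simp add: p prod_encode_def)
    then show "fst p + snd p < k" using triangle_mono[of k "i + j"] by (force simp: p)
  next
    assume "fst p + snd p < k"
    then have "triangle (Suc (i + j)) \<le> triangle k" by (intro triangle_mono) (simp add: p)
    then show "prod_encode p < triangle k" by (simp add: p prod_encode_def)
  qed
qed

lemma ideal_generated_least: "is_ideal R I \<Longrightarrow> S \<subseteq> I \<Longrightarrow> ideal_generated R S \<subseteq> I"
  unfolding ideal_generated_def by blast

lemma ideal_generated_closed:
  "0 \<in> ideal_generated R S"
  "a \<in> ideal_generated R S \<Longrightarrow> b \<in> ideal_generated R S \<Longrightarrow> a + b \<in> ideal_generated R S"
  "r \<in> R \<Longrightarrow> a \<in> ideal_generated R S \<Longrightarrow> r * a \<in> ideal_generated R S"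
  "a \<in> S \<Longrightarrow> a \<in> ideal_generated R S"
  unfolding ideal_generated_def is_ideal_def by blast+

context plane_valuation
begin

text \<open>The right side consists of the functions of order at least \<open>k\<close> at the
  centre. A factor from the maximal ideal has no constant term, so each multiplication raises the
  order by at least one.\<close>

lemma max_ideal_power_subset: "max_ideal_power u v k \<subseteq> encode_ideal (triangle k)"
proof (induction k)
  case 0
  show ?case
  proof
    fix f assume "f \<in> max_ideal_power u v 0"
    then have "f \<in> \<O>" by simp
    then show "f \<in> encode_ideal (triangle 0)"
      by (rule local_ringE) (use encode_idealI[of _ 0] in simp)
  qed
next
  case (Suc k)
  have "a * b \<in> encode_ideal (triangle (Suc k))" if a: "a \<in> max_ideal u v" and b: "b \<in> max_ideal_power u v k" for a b
  proof -
    obtain f g where fg: "coeff2 f (0, 0) = 0" "coeff2 g (0, 0) \<noteq> 0" "a = eval2 f u v / eval2 g u v"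
      using a unfolding max_ideal_def coeff2_def by auto
    obtain f' g' where fg': "coeff2 g' (0, 0) \<noteq> 0" "b = eval2 f' u v / eval2 g' u v"
      "\<forall>p. prod_encode p < triangle k \<longrightarrow> coeff2 f' p = 0"
      using subsetD[OF Suc.IH b] by (rule encode_idealE)
    have "a * b = eval2 (f * f') u v / eval2 (g * g') u v"
      by (simp add: fg fg' eval2.map_mult)
    also have "\<dots> \<in> encode_ideal (triangle (Suc k))"
    proof (rule encode_idealI)
      show "coeff2 (g * g') (0, 0) \<noteq> 0" using fg fg' by simp
      fix p assume p: "prod_encode p < triangle (Suc k)"
      obtain i j where ij: "p = (i, j)" by (cases p)
      have "coeff2 f (i', j') * coeff2 f' (i - i', j - j') = 0" if "i' \<le> i" "j' \<le> j" for i' j'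
      proof (cases "(i', j') = (0, 0)")
        case True
        then show ?thesis using fg(1) by simp
      next
        case False
        then have "(i - i') + (j - j') < k" using p that
          by (simp only: prod_encode_less_triangle ij) auto
        then have "coeff2 f' (i - i', j - j') = 0"
          using fg'(3) by (simp only: prod_encode_less_triangle) simp
        then show ?thesis by simp
      qed
      then show "coeff2 (f * f') p = 0" unfolding ij by (rule coeff2_mult_eq_0)
    qed
    finally show ?thesis .
  qed
  then have "{a * b | a b. a \<in> max_ideal u v \<and> b \<in> max_ideal_power u v k} \<subseteq> encode_ideal (triangle (Suc k))"
    by blast
  then show ?case
    unfolding max_ideal_power.simps by (rule ideal_generated_least[OF encode_ideal_is_ideal])
qed

text \<open>Clearing the denominator multiplies a coefficient of lowest degree by the nonzero
  constant term of \<open>b\<close>, so that term survives in the numerator.\<close>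

lemma encode_ideal_eval2:
  assumes "eval2 h u v \<in> encode_ideal (triangle k)" "coeff2 h p \<noteq> 0"
  shows "k \<le> fst p + snd p"
proof -
  obtain a b where ab: "coeff2 b (0, 0) \<noteq> 0" "eval2 h u v = eval2 a u v / eval2 b u v"
    "\<forall>p. prod_encode p < triangle k \<longrightarrow> coeff2 a p = 0"
    using assms(1) by (rule encode_idealE)
  have "eval2 (h * b) u v = eval2 a u v"
    using ab(2) coeff2_00_nonzero[OF ab(1)] by (simp add: eval2.map_mult)
  then have hb: "h * b = a" by (rule alg_indep_cancel[OF indep])
  have "h \<noteq> 0" using assms(2) by auto
  then obtain q where q: "coeff2 h q \<noteq> 0" "\<And>p. coeff2 h p \<noteq> 0 \<Longrightarrow> fst q + snd q \<le> fst p + snd p"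
    using coeff2_order_exists by blast
  obtain i j where ij: "q = (i, j)" by (cases q)
  have "coeff2 h (i', j') = 0" if "i' \<le> i" "j' \<le> j" "(i', j') \<noteq> (i, j)" for i' j'
    by (rule ccontr) (use q(2)[of "(i', j')"] that in \<open>auto simp: ij\<close>)
  then have "coeff2 a q \<noteq> 0"
    using coeff2_mult_lowest[of i j h b] q(1) ab(1) by (simp add: hb ij)
  then have "\<not> prod_encode q < triangle k" using ab(3) by blast
  then have "k \<le> fst q + snd q" by (simp add: prod_encode_less_triangle)
  then show ?thesis using q(2)[OF assms(2)] by simp
qed

text \<open>The \<open>k\<close>-th power of the maximal ideal holds only functions of order at
  least \<open>k\<close>, so in the m-adic case the Izumi-type bound is valid with constant
  1.\<close>

lemma madic_val_le:
  assumes "madic u v \<nu>" "coeff2 h p \<noteq> 0"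
  shows "\<nu> (eval2 h u v) \<le> int (fst p + snd p)"
proof (cases "0 \<le> \<nu> (eval2 h u v)")
  case True
  have "h \<noteq> 0" using assms(2) by auto
  then have "eval2 h u v \<in> \<O> - {0}" by (simp add: eval2_local_ring)
  then have "eval2 h u v \<in> max_ideal_power u v (nat (\<nu> (eval2 h u v)))"
    using assms(1) True unfolding madic_def by auto
  then have "nat (\<nu> (eval2 h u v)) \<le> fst p + snd p"
    using max_ideal_power_subset encode_ideal_eval2 assms(2) by blast
  then show ?thesis by simp
qed simp

lemma max_ideal_power_mult:
  assumes "f \<in> \<O>" "g \<in> max_ideal_power u v k"
  shows "f * g \<in> max_ideal_power u v k"
  using assms local_ring_mult by (cases k) (simp_all add: ideal_generated_closed)

lemma max_ideal_power_monomial: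
  "k \<le> i + j \<Longrightarrow> u ^ i * v ^ j \<in> max_ideal_power u v k"
proof (induction k arbitrary: i j)
  case 0
  then show ?case by (simp add: local_ring_mult local_ring_power local_ring_basic)
next
  case (Suc k)
  have step: "x * m \<in> max_ideal_power u v (Suc k)" if "x \<in> max_ideal u v" "m \<in> max_ideal_power u v k" for x m
    using that by (auto intro!: ideal_generated_closed(4))
  show ?case
  proof (cases i)
    case 0
    then obtain j' where "j = Suc j'" "k \<le> i + j'" using Suc.prems by (cases j) auto
    then show ?thesis using step[OF max_ideal_uv(2) Suc.IH[of i j']] by (simp add: mult.left_commute)
  next
    case (Suc i')
    then show ?thesis using step[OF max_ideal_uv(1) Suc.IH[of i' j]] Suc.prems by (simp add: mult.assoc)
  qed
qed

lemma max_ideal_power_sum: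
  assumes "\<And>i. i \<in> A \<Longrightarrow> f i \<in> max_ideal_power u v k"
  shows "sum f A \<in> max_ideal_power u v k"
proof -
  have "0 \<in> max_ideal_power u v k"
    by (cases k) (simp_all add: local_ring_basic ideal_generated_closed)
  moreover have "a + b \<in> max_ideal_power u v k" if "a \<in> max_ideal_power u v k" "b \<in> max_ideal_power u v k" for a b
    using that by (cases k) (simp_all add: local_ring_add ideal_generated_closed)
  ultimately show ?thesis
    using assms by (induction A rule: infinite_finite_induct) auto
qed

text \<open>Unit denominators do not affect membership in powers of the maximal ideal, and for
  polynomials it is decided by the lowest degree. This recognises the valuation of a single blowup
  as m-adic.\<close>

lemma madicI:
  assumes order: "\<And>h q. coeff2 h q \<noteq> 0 \<Longrightarrow> (\<And>p. coeff2 h p \<noteq> 0 \<Longrightarrow> fst q + snd q \<le> fst p + snd p) \<Longrightarrow>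
    \<nu> (eval2 h u v) = int (fst q + snd q)"
  shows "madic u v \<nu>"
  unfolding madic_def
proof (intro ballI allI)
  fix f k assume f: "f \<in> \<O> - {0}"
  obtain a b where ab: "coeff2 b (0, 0) \<noteq> 0" "f = eval2 a u v / eval2 b u v"
    using f by (blast elim: local_ringE)
  have "a \<noteq> 0" using f ab by (auto simp: eval2.map_zero)
  then obtain q where q: "coeff2 a q \<noteq> 0" "\<And>p. coeff2 a p \<noteq> 0 \<Longrightarrow> fst q + snd q \<le> fst p + snd p"
    using coeff2_order_exists by blast
  have val: "\<nu> f = int (fst q + snd q)"
    using order[OF q] val_fraction[OF \<open>a \<noteq> 0\<close> ab(1)] ab(2) by simp
  show "f \<in> max_ideal_power u v k \<longleftrightarrow> int k \<le> \<nu> f"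
  proof
    assume "f \<in> max_ideal_power u v k"
    then have "eval2 b u v * f \<in> max_ideal_power u v k"
      by (intro max_ideal_power_mult eval2_local_ring)
    then have "eval2 a u v \<in> encode_ideal (triangle k)"
      using max_ideal_power_subset coeff2_00_nonzero[OF ab(1)] by (auto simp: ab(2))
    then show "int k \<le> \<nu> f" using encode_ideal_eval2 q(1) val by (simp only: of_nat_le_iff)
  next
    assume "int k \<le> \<nu> f"
    then have k: "k \<le> fst q + snd q" by (simp only: val of_nat_le_iff)
    have "eval2 a u v \<in> max_ideal_power u v k"
      unfolding eval2_supp2 mult.assoc
    proof (rule max_ideal_power_sum)
      fix p assume "p \<in> supp2 a"
      then have "k \<le> fst p + snd p" using q(2)[of p] k by simp
      then show "const_fun (coeff2 a p) * (u ^ fst p * v ^ snd p) \<in> max_ideal_power u v k"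
        by (intro max_ideal_power_mult local_ring_basic max_ideal_power_monomial)
    qed
    moreover have "1 / eval2 b u v \<in> \<O>"
      using local_ringI[OF ab(1), of 1] by (simp add: eval2.map_one)
    ultimately have "1 / eval2 b u v * eval2 a u v \<in> max_ideal_power u v k"
      using max_ideal_power_mult by blast
    then show "f \<in> max_ideal_power u v k" by (simp add: ab(2))
  qed
qed

text \<open>The Izumi-type bound confines the values in degree \<open>d\<close> to a finite
  interval, so the maximum exists and \<open>GREATEST\<close> denotes it.\<close>

lemma mu_set:
  defines "S d \<equiv> {\<nu> (eval2 h u v) | h. h \<noteq> 0 \<and> total_degree_le h d}"
  shows "mu u v \<nu> d \<in> S d" "k \<in> S d \<Longrightarrow> k \<le> mu u v \<nu> d"
proof -
  have "\<nu> (eval2 h u v) \<in> {0..int (C * d)}" if h: "h \<noteq> 0" "total_degree_le h d" for h d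
  proof -
    obtain p where p: "coeff2 h p \<noteq> 0" using coeff2_nonzero[OF h(1)] by blast
    have "fst p + snd p \<le> d" using p h(2) by (auto simp: total_degree_le_coeff2)
    then have "int (C * (fst p + snd p)) \<le> int (C * d)" by (simp only: of_nat_le_iff mult_le_mono2)
    then have "\<nu> (eval2 h u v) \<le> int (C * d)" using val_eval2_le[OF p] by linarith
    moreover have "0 \<le> \<nu> (eval2 h u v)"
      using val_local_ring[OF eval2_local_ring[of h]] h(1) by (simp add: val_ge_def)
    ultimately show ?thesis by simp
  qed
  then have "S d \<subseteq> {0..int (C * d)}" for d unfolding S_def by blast
  then have fin: "finite (S d)" for d by (rule finite_subset) simp
  have "\<nu> (eval2 1 u v) \<in> S d" for d
    unfolding S_def by (intro CollectI exI[of _ 1]) (simp add: total_degree_le_def)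
  then have ne: "S d \<noteq> {}" for d by blast
  have "mu u v \<nu> d = Max (S d)"
    unfolding mu_def
  proof (rule Greatest_equality)
    show "\<exists>h. h \<noteq> 0 \<and> total_degree_le h d \<and> \<nu> (eval2 h u v) = Max (S d)"
      using Max_in[OF fin ne, of d] unfolding S_def by auto
    show "k \<le> Max (S d)" if "\<exists>h. h \<noteq> 0 \<and> total_degree_le h d \<and> \<nu> (eval2 h u v) = k" for k
      using that by (intro Max_ge[OF fin]) (auto simp: S_def)
  qed
  then show "mu u v \<nu> d \<in> S d" "k \<in> S d \<Longrightarrow> k \<le> mu u v \<nu> d"
    using Max_in[OF fin ne] Max_ge[OF fin] by auto
qed

text \<open>Multiplying polynomials makes \<open>mu\<close> superadditive, so the limit exists and
  inherits the bound from the terms with positive \<open>d\<close>.\<close>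

lemma mu_hat_le:
  fixes B :: real
  assumes le: "\<And>h d. h \<noteq> 0 \<Longrightarrow> total_degree_le h d \<Longrightarrow> \<nu> (eval2 h u v) \<le> real d * B"
  shows "mu_hat u v \<nu> \<le> B"
proof -
  let ?a = "\<lambda>d. real_of_int (mu u v \<nu> d)"
  have attained: "\<exists>h. h \<noteq> 0 \<and> total_degree_le h d \<and> mu u v \<nu> d = \<nu> (eval2 h u v)" for d
    using mu_set(1)[of d] by blast
  have le_mu: "\<nu> (eval2 h u v) \<le> mu u v \<nu> d" if "h \<noteq> 0" "total_degree_le h d" for h d
    using that by (intro mu_set(2)) blast
  have bound: "?a d \<le> B * real d" for d
    using attained[of d] le by (metis mult.commute)
  have super: "?a m + ?a n \<le> ?a (m + n)" for m n
  proof -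
    obtain f g where fg: "f \<noteq> 0" "total_degree_le f m" "mu u v \<nu> m = \<nu> (eval2 f u v)"
      "g \<noteq> 0" "total_degree_le g n" "mu u v \<nu> n = \<nu> (eval2 g u v)"
      using attained by meson
    have "total_degree_le (f * g) (m + n)"
      using degree_less_mult[of f "Suc m" g n] fg by (simp add: total_degree_le_iff_less)
    then have "\<nu> (eval2 (f * g) u v) \<le> mu u v \<nu> (m + n)" using fg by (intro le_mu) auto
    then show ?thesis using fg by (simp add: eval2.map_mult val_mult)
  qed
  have "0 \<le> ?a n" for n
    using le_mu[of 1 n] by (simp add: total_degree_le_def eval2.map_one val_one)
  then have "convergent (\<lambda>d. ?a d / real d)"
    using super bound by (intro superadditive_convergent)
  then have "(\<lambda>d. ?a d / real d) \<longlonglongrightarrow> mu_hat u v \<nu>"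
    unfolding mu_hat_def by (simp add: convergent_LIMSEQ_iff)
  then show ?thesis
  proof (rule LIMSEQ_le_const2)
    show "\<exists>N. \<forall>n\<ge>N. ?a n / real n \<le> B"
      using bound by (intro exI[of _ 1]) (auto simp: field_simps)
  qed
qed

text \<open>Division with remainder by the line. Modulo \<open>l\<close> both \<open>u\<close> and
  \<open>v\<close> are multiples of \<open>w\<close>, so the remainder is the restriction to the
  line, written as a polynomial in \<open>w\<close>.\<close>

lemma divide_line:
  assumes u: "u = const_fun a1 * l + const_fun b1 * w" and v: "v = const_fun a2 * l + const_fun b2 * w"
    and w: "w = eval2 L u v" "degree_less L (Suc (Suc 0))"
    and h: "degree_less h (Suc d)"
  shows "\<exists>g r. degree_less g d \<and> degree r \<le> d \<and>
    eval2 h u v = l * eval2 g u v + poly (map_poly const_fun r) w"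
proof -
  define P where "P d f \<longleftrightarrow> (\<exists>g r. degree_less g d \<and> degree r \<le> d \<and>
    f = l * eval2 g u v + poly (map_poly const_fun r) w)" for d f
  \<comment> \<open>A remainder multiplied by \<open>l\<close> moves into the quotient and must then
    be read as a polynomial in \<open>u\<close>, \<open>v\<close>. Since \<open>L\<close> has degree
    at most one, this does not raise the degree.\<close>
  have uni: "\<exists>g. degree_less g (Suc d) \<and> poly (map_poly const_fun r) w = eval2 g u v"
    if "degree r \<le> d" for r :: "'a poly" and d
    using that
  proof (induction r arbitrary: d)
    case 0
    then show ?case by (intro exI[of _ 0]) (simp add: eval2.map_zero)
  next
    case (pCons c r)
    show ?case
    proof (cases "r = 0")
      case True
      then show ?thesis using degree_less_const
        by (intro exI[of _ "[:[:c:]:]"]) (simp add: const_fun.poly_map_pCons)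
    next
      case False
      then obtain d' where d': "d = Suc d'" "degree r \<le> d'"
        using pCons.prems by (cases d) auto
      then obtain g where g: "degree_less g (Suc d')" "poly (map_poly const_fun r) w = eval2 g u v"
        using pCons.IH by blast
      have "degree_less (g * L) (Suc d' + 1)" using g(1) w(2) by (intro degree_less_mult) simp_all
      then have "degree_less ([:[:c:]:] + g * L) (Suc d)"
        using d' by (intro degree_less_add degree_less_const) simp
      moreover have "poly (map_poly const_fun (pCons c r)) w = eval2 ([:[:c:]:] + g * L) u v"
        unfolding const_fun.poly_map_pCons eval2.map_add eval2.map_mult eval2_const w(1)[symmetric] g(2)
        by (simp add: mult.commute)
      ultimately show ?thesis by blast
    qed
  qed
  have P_add: "P d (f + g)" if f: "P d f" and g: "P d g" for d f g
  proof -
    obtain a r a' r' where *: "degree_less a d" "degree r \<le> d" "f = l * eval2 a u v + poly (map_poly const_fun r) w"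
      "degree_less a' d" "degree r' \<le> d" "g = l * eval2 a' u v + poly (map_poly const_fun r') w"
      using f g unfolding P_def by blast
    have "f + g = l * eval2 (a + a') u v + poly (map_poly const_fun (r + r')) w"
      by (simp add: * eval2.map_add const_fun.poly_map_add algebra_simps)
    then show ?thesis unfolding P_def using * by (blast intro: degree_less_add degree_add_le)
  qed
  have P_const: "P d (const_fun c)" for d c
    unfolding P_def by (intro exI[of _ 0] exI[of _ "[:c:]"]) (simp add: eval2.map_zero const_fun.poly_map_pCons)
  \<comment> \<open>Both \<open>u\<close> and \<open>v\<close> are of the form
    \<open>a * l + b * w\<close>. Times a remainder, the first summand joins the quotient and the
    second is a remainder of degree at most one more.\<close>
  have P_step: "P (Suc d) ((const_fun a * l + const_fun b * w) * f)"
    if f: "P d f" and z: "const_fun a * l + const_fun b * w = eval2 Z u v" "degree_less Z (Suc (Suc 0))" for a b f d Z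
  proof -
    obtain g r where *: "degree_less g d" "degree r \<le> d" "f = l * eval2 g u v + poly (map_poly const_fun r) w"
      using f unfolding P_def by blast
    obtain s where s: "degree_less s (Suc d)" "poly (map_poly const_fun r) w = eval2 s u v"
      using uni[OF *(2)] by blast
    let ?g = "g * Z + [:[:a:]:] * s"
    have "degree_less (g * Z) (d + Suc 0)" using *(1) z(2) by (rule degree_less_mult)
    moreover have "degree_less (s * [:[:a:]:]) (Suc d + 0)" using s(1) degree_less_const by (rule degree_less_mult)
    ultimately have "degree_less ?g (Suc d)" using degree_less_add by (simp add: mult.commute)
    moreover have "degree (pCons 0 (smult b r)) \<le> Suc d"
      using *(2) by (meson degree_pCons_le degree_smult_le le_trans Suc_le_mono)
    moreover have "(const_fun a * l + const_fun b * w) * f = l * eval2 ?g u v + poly (map_poly const_fun (pCons 0 (smult b r))) w"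
      unfolding *(3) eval2.map_add eval2.map_mult eval2_const z(1)[symmetric] s(2)[symmetric]
        const_fun.poly_map_pCons const_fun.poly_map_smult const_fun.map_zero
      by (simp add: algebra_simps)
    ultimately show ?thesis unfolding P_def by blast
  qed
  have Pu: "P (Suc d) (u * f)" if "P d f" for d f
  proof -
    have "u = eval2 [:[:0, 1:], [:0:]:] u v" by (simp only: eval2_linear) (simp add: const_fun.map_zero const_fun.map_one)
    then show ?thesis using P_step[OF that, of a1 b1] degree_less_linear u by metis
  qed
  have Pv: "P (Suc d) (v * f)" if "P d f" for d f
  proof -
    have "v = eval2 [:[:0, 0:], [:1:]:] u v" by (simp only: eval2_linear) (simp add: const_fun.map_zero const_fun.map_one)
    then show ?thesis using P_step[OF that, of a2 b2] degree_less_linear v by metis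
  qed
  have P_mono: "P e f" if "P d f" "d \<le> e" for d e f
  proof -
    obtain g r where "degree_less g d" "degree r \<le> d" "f = l * eval2 g u v + poly (map_poly const_fun r) w"
      using \<open>P d f\<close> unfolding P_def by blast
    then show ?thesis
      unfolding P_def using \<open>d \<le> e\<close> degree_less_mono by (intro exI[of _ g] exI[of _ r]) auto
  qed
  have mono: "P (i + j) (const_fun c * u ^ i * v ^ j)" for c i j
  proof -
    have "P i (const_fun c * u ^ i)"
    proof (induction i)
      case (Suc i)
      show ?case using Pu[OF Suc] by (simp add: mult_ac)
    qed (simp add: P_const)
    then show ?thesis
    proof (induction j)
      case (Suc j)
      show ?case using Pv[OF Suc.IH[OF Suc.prems]] by (simp add: mult_ac)
    qed simp
  qed
  have P_sum: "P d (sum F A)" if "\<And>p. p \<in> A \<Longrightarrow> P d (F p)" for F and A :: "(nat \<times> nat) set"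
    using that P_const[of d 0]
    by (induction A rule: infinite_finite_induct) (auto simp: const_fun.map_zero intro: P_add)
  have "P d (const_fun (coeff2 h p) * u ^ fst p * v ^ snd p)" if "p \<in> supp2 h" for p
  proof -
    have "fst p + snd p \<le> d" using that h by (force simp: degree_less_def not_less_eq_eq[symmetric])
    then show ?thesis using P_mono[OF mono] by blast
  qed
  then have "P d (eval2 h u v)" unfolding eval2_supp2 by (intro P_sum)
  then show ?thesis unfolding P_def .
qed

end

section \<open>The tangent line\<close>

text \<open>The inductive rules append blowups at the end, whereas the tangent direction is read off
  the first one.\<close>

lemma blowup_coordinates_first:
  assumes "blowup_coordinates u v x y"
  shows "(x = u \<and> y = v) \<or> (\<exists>c. blowup_coordinates u (v / u - const_fun c) x y) \<or>
    blowup_coordinates (u / v) v x y"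
  using assms
proof (induction rule: blowup_coordinates.induct)
  case base
  then show ?case by simp
next
  case (finite_point x y c)
  then show ?case
    by (elim disjE exE conjE) (blast intro: blowup_coordinates.intros)+
next
  case (infinite_point x y)
  then show ?case
    by (elim disjE exE conjE) (blast intro: blowup_coordinates.intros)+
qed

section \<open>Values of polynomials against their degree\<close>

lemma poly_factor_X:
  fixes r :: "'a::field poly"
  assumes "r \<noteq> 0"
  shows "\<exists>k s. k \<le> degree r \<and> coeff s 0 \<noteq> 0 \<and>
    (\<forall>w. poly (map_poly const_fun r) w = w ^ k * poly (map_poly const_fun s) w)"
  using assms
proof (induction r)
  case 0
  then show ?case by simp
next
  case (pCons c r)
  show ?case
  proof (cases "c = 0")
    case True
    then have "r \<noteq> 0" using pCons.hyps by auto
    then obtain k s where "k \<le> degree r" "coeff s 0 \<noteq> 0"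
      "\<And>w. poly (map_poly const_fun r) w = w ^ k * poly (map_poly const_fun s) w"
      using pCons.IH by blast
    then show ?thesis using True \<open>r \<noteq> 0\<close>
      by (intro exI[of _ "Suc k"] exI[of _ s]) (simp add: const_fun.poly_map_pCons const_fun.map_zero mult.assoc)
  next
    case False
    then show ?thesis by (intro exI[of _ 0] exI[of _ "pCons c r"]) simp
  qed
qed

context plane_valuation
begin

text \<open>As \<open>L\<close> vanishes at the centre, the constant term of \<open>r\<close> is the
  value there; what is left of a restriction after removing all powers of \<open>w\<close> is
  therefore a unit.\<close>

lemma poly_local_unit:
  assumes "coeff2 L (0, 0) = 0"
  shows "\<exists>g. poly (map_poly const_fun r) (eval2 L u v) = eval2 g u v \<and> coeff2 g (0, 0) = coeff r 0"
proof (induction r)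
  case 0
  then show ?case by (intro exI[of _ 0]) (simp add: eval2.map_zero)
next
  case (pCons c r)
  then obtain g where g: "poly (map_poly const_fun r) (eval2 L u v) = eval2 g u v" by blast
  have "poly (map_poly const_fun (pCons c r)) (eval2 L u v) = eval2 ([:[:c:]:] + L * g) u v"
    unfolding const_fun.poly_map_pCons eval2.map_add eval2.map_mult eval2_const g ..
  moreover have "coeff2 ([:[:c:]:] + L * g) (0, 0) = coeff (pCons c r) 0"
    using assms by (simp only: coeff2_add coeff2_mult_00) (simp add: coeff2_def)
  ultimately show ?case by blast
qed

text \<open>Induction along division by the line, with \<open>B\<close> large enough for both cases:
  a factor \<open>l\<close> uses up one degree and contributes \<nu>(l); otherwise the order
  \<open>k\<close> of the restriction at the centre is at most \<open>d\<close> and enters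
  \<open>vol_bounds\<close>.\<close>

lemma val_le_degree:
  fixes B :: real
  assumes l: "l \<in> \<O>" "l \<noteq> 0" "0 < \<nu> l"
    and uv: "u = const_fun a1 * l + const_fun b1 * w" "v = const_fun a2 * l + const_fun b2 * w"
    and w: "w = eval2 L u v" "degree_less L (Suc (Suc 0))" "coeff2 L (0, 0) = 0"
    and B: "real_of_int (\<nu> l) \<le> B" "inverse (vol u v \<nu>) \<le> B * \<nu> l"
    and h: "h \<noteq> 0" "degree_less h (Suc d)"
  shows "\<nu> (eval2 h u v) \<le> real d * B"
  using h
proof (induction d arbitrary: h rule: less_induct)
  case (less d)
  have "0 \<le> B" using B(1) l(3) by linarith
  have wO: "w \<in> \<O>" unfolding w(1) by (rule eval2_local_ring)
  obtain g r where gr: "degree_less g d" "degree r \<le> d"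
    "eval2 h u v = l * eval2 g u v + poly (map_poly const_fun r) w"
    using divide_line[OF uv w(1,2) less.prems(2)] by blast
  show ?case
  proof (cases "r = 0")
    case True
    then have eq: "eval2 h u v = l * eval2 g u v" using gr by simp
    then have "g \<noteq> 0" using less.prems(1) by (metis eval2_nonzero_iff eval2.map_zero mult_zero_right)
    then obtain d' where d': "d = Suc d'" using gr(1) by (cases d) auto
    have "\<nu> (eval2 g u v) \<le> real d' * B" using less.IH[of d' g] d' gr(1) \<open>g \<noteq> 0\<close> by simp
    moreover have "\<nu> (eval2 h u v) = \<nu> l + \<nu> (eval2 g u v)"
      unfolding eq using l(2) \<open>g \<noteq> 0\<close> by (simp add: val_mult)
    ultimately show ?thesis using B(1) by (simp add: d' algebra_simps)
  next
    case False
    show ?thesis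
    proof (cases "0 < \<nu> (eval2 h u v)")
      \<comment> \<open>The bound through the volume requires a positive value; without it
        \<open>0 \<le> B\<close> suffices.\<close>
      case False
      have "0 \<le> real d * B" using \<open>0 \<le> B\<close> by simp
      then show ?thesis using False by linarith
    next
      case True
      obtain k s where ks: "k \<le> degree r" "coeff s 0 \<noteq> 0"
        "poly (map_poly const_fun r) w = w ^ k * poly (map_poly const_fun s) w"
        using poly_factor_X[OF False] by blast
      obtain g' where g': "poly (map_poly const_fun s) w = eval2 g' u v" "coeff2 g' (0, 0) = coeff s 0"
        using poly_local_unit[OF w(3), of s] w(1) by auto
      have unit: "coeff2 g' (0, 0) \<noteq> 0" using g'(2) ks(2) by simp
      then have nz: "eval2 g' u v \<noteq> 0" using coeff2_00_nonzero by simp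
      \<comment> \<open>The restriction is \<open>w ^ k\<close> times a unit; dividing by that unit
        exhibits \<open>w ^ k\<close> in the ideal of \<open>h\<close> and \<open>l\<close>.\<close>
      have wk: "w ^ k = (1 / eval2 g' u v) * eval2 h u v + - (eval2 g u v / eval2 g' u v) * l"
        using nz unfolding gr(3) ks(3) g'(1) by (simp add: field_simps)
      have r1: "1 / eval2 g' u v \<in> \<O>"
        using local_ringI[OF unit, of 1] by (simp add: eval2.map_one)
      have r2: "- (eval2 g u v / eval2 g' u v) \<in> \<O>"
        using local_ringI[OF unit, of g] by (rule local_ring_uminus)
      have hnz: "eval2 h u v \<noteq> 0" using less.prems(1) by simp
      have vol: "0 < vol u v \<nu>" "vol u v \<nu> * (\<nu> (eval2 h u v) * \<nu> l) \<le> real k"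
        using vol_bounds[OF eval2_local_ring l(1) wO hnz True l(2,3) uv wk r1 r2] by auto
      have "\<nu> (eval2 h u v) * \<nu> l \<le> real k * inverse (vol u v \<nu>)"
        using vol by (simp add: field_simps)
      also have "\<dots> \<le> real d * (B * \<nu> l)"
        using B(2) ks(1) gr(2) vol(1) by (intro mult_mono) auto
      finally have "real_of_int (\<nu> (eval2 h u v)) * \<nu> l \<le> (real d * B) * \<nu> l" by (simp add: mult.assoc)
      then show ?thesis using l(3) by (simp add: mult_le_cancel_right)
    qed
  qed
qed

section \<open>Lines through the centre and the tangent value\<close>

lemma line_equation_eval2:
  fixes l :: "'a ^ 3"
  shows "line_equation u v l = eval2 [:[:l $ 1, l $ 2:], [:l $ 3:]:] u v"
  by (simp add: line_equation_def)

lemma line_equation_nonzero: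
  fixes l :: "'a ^ 3"
  assumes "l \<noteq> 0"
  shows "line_equation u v l \<noteq> 0"
proof
  assume "line_equation u v l = 0"
  then have "[:[:l $ 1, l $ 2:], [:l $ 3:]:] = 0"
    unfolding line_equation_eval2 by (simp only: eval2_nonzero_iff)
  then have "l = 0" by (simp add: vec_eq_iff forall_3)
  then show False using assms by simp
qed

lemma tangent_line_through:
  fixes l :: "'a ^ 3"
  assumes "beta0 u v \<nu> < \<nu> (line_equation u v l)"
  shows "l $ 1 = 0"
proof (rule ccontr)
  assume "l $ 1 \<noteq> 0"
  then have "\<nu> (line_equation u v l) = 0"
    unfolding line_equation_eval2 by (intro val_eval2_unit) (simp add: coeff2_def)
  then show False using assms beta0_pos by simp
qed

text \<open>The equation of the line can be solved for \<open>u\<close> or for \<open>v\<close>; the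
  other one serves as complementary coordinate.\<close>

lemma tangent_coordinate:
  fixes l :: "'a ^ 3"
  assumes "l \<noteq> 0" "l $ 1 = 0"
  obtains a1 b1 a2 b2 L where "u = const_fun a1 * line_equation u v l + const_fun b1 * eval2 L u v"
    "v = const_fun a2 * line_equation u v l + const_fun b2 * eval2 L u v"
    "degree_less L (Suc (Suc 0))" "coeff2 L (0, 0) = 0"
proof (cases "l $ 3 = 0")
  case False
  have "u = const_fun 0 * line_equation u v l + const_fun 1 * eval2 [:[:0, 1:], [:0:]:] u v"
    unfolding eval2_linear by (simp add: const_fun.map_zero const_fun.map_one)
  moreover have "v = const_fun (1 / l $ 3) * line_equation u v l + const_fun (- l $ 2 / l $ 3) * eval2 [:[:0, 1:], [:0:]:] u v"
  proof -
    have e: "const_fun (1 / l $ 3) * const_fun (l $ 3) = 1"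
      "const_fun (1 / l $ 3) * const_fun (l $ 2) + const_fun (- l $ 2 / l $ 3) = 0"
      using False unfolding const_fun.map_mult[symmetric] const_fun.map_add[symmetric]
      by (simp_all add: const_fun.map_one const_fun.map_zero)
    have "const_fun (1 / l $ 3) * line_equation u v l + const_fun (- l $ 2 / l $ 3) * eval2 [:[:0, 1:], [:0:]:] u v
        = (const_fun (1 / l $ 3) * const_fun (l $ 2) + const_fun (- l $ 2 / l $ 3)) * u
          + const_fun (1 / l $ 3) * const_fun (l $ 3) * v"
      unfolding eval2_linear line_equation_def assms(2) const_fun.map_zero const_fun.map_one
      by (simp only: algebra_simps mult_zero_left mult_1_left add_0_left add_0_right)
    then show ?thesis unfolding e by simp
  qed
  ultimately show thesis
    by (rule that[OF _ _ degree_less_linear]) (simp add: coeff2_def)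
next
  case True
  then have l2: "l $ 2 \<noteq> 0" using assms by (auto simp: vec_eq_iff forall_3)
  have "const_fun (1 / l $ 2) * const_fun (l $ 2) = 1"
    using l2 unfolding const_fun.map_mult[symmetric] by (simp add: const_fun.map_one)
  then have "u = const_fun (1 / l $ 2) * line_equation u v l + const_fun 0 * eval2 [:[:0, 0:], [:1:]:] u v"
    unfolding line_equation_def
    by (simp add: const_fun.map_zero assms(2) True mult.assoc[symmetric])
  moreover have "v = const_fun 0 * line_equation u v l + const_fun 1 * eval2 [:[:0, 0:], [:1:]:] u v"
    unfolding eval2_linear by (simp add: const_fun.map_zero const_fun.map_one)
  ultimately show thesis
    by (rule that[OF _ _ degree_less_linear]) (simp add: coeff2_def)
qed

text \<open>If the determinant \<open>D\<close> of the two equations were nonzero, Cramer's rule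
  would push both \<open>u\<close> and \<open>v\<close> above \<open>beta0\<close>, the minimum of
  their values. So the equations are proportional, and nonzero constants have value 0.\<close>

lemma tangent_value_unique:
  fixes l l' :: "'a ^ 3"
  assumes l: "l \<noteq> 0" "beta0 u v \<nu> < \<nu> (line_equation u v l)"
    and l': "l' \<noteq> 0" "beta0 u v \<nu> < \<nu> (line_equation u v l')"
  shows "\<nu> (line_equation u v l) = \<nu> (line_equation u v l')"
proof -
  let ?f = "line_equation u v l" and ?g = "line_equation u v l'"
  have z: "l $ 1 = 0" "l' $ 1 = 0" using tangent_line_through l(2) l'(2) by auto
  have nz: "?f \<noteq> 0" "?g \<noteq> 0" using line_equation_nonzero l(1) l'(1) by auto
  define D where "D = l $ 2 * l' $ 3 - l $ 3 * l' $ 2"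
  have Du: "const_fun D * u = const_fun (l' $ 3) * ?f + const_fun (- l $ 3) * ?g"
    unfolding line_equation_def z D_def
    by (simp add: const_fun.map_zero const_fun.map_mult const_fun.map_diff const_fun.map_uminus algebra_simps)
  have Dv: "const_fun D * v = const_fun (l $ 2) * ?g + const_fun (- l' $ 2) * ?f"
    unfolding line_equation_def z D_def
    by (simp add: const_fun.map_zero const_fun.map_mult const_fun.map_diff const_fun.map_uminus algebra_simps)
  have ge: "val_ge (beta0 u v \<nu> + 1) (const_fun c * f)" if "f = ?f \<or> f = ?g" for c f
  proof -
    have "val_ge (0 + (beta0 u v \<nu> + 1)) (const_fun c * f)"
      using val_local_ring[OF local_ring_basic(5)[of c]] that l l' by (intro val_ge_mult) (auto simp: val_ge_def)
    then show ?thesis by simp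
  qed
  have "D = 0"
  proof (rule ccontr)
    assume D: "D \<noteq> 0"
    have "val_ge (beta0 u v \<nu> + 1) (const_fun D * u)" "val_ge (beta0 u v \<nu> + 1) (const_fun D * v)"
      unfolding Du Dv by (intro val_ge_add ge; simp)+
    then have "beta0 u v \<nu> < \<nu> u" "beta0 u v \<nu> < \<nu> v"
      using D uv_nonzero by (auto simp: val_ge_def val_mult val_const)
    then show False using beta0_eq by simp
  qed
  then have e: "const_fun (l' $ 3) * ?f = const_fun (l $ 3) * ?g" "const_fun (l' $ 2) * ?f = const_fun (l $ 2) * ?g"
    using Du Dv by (simp_all add: const_fun.map_zero const_fun.map_uminus)
  have "\<nu> ?f = \<nu> ?g" if "const_fun a * ?f = const_fun b * ?g" "b \<noteq> 0" for a b
  proof -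
    have "const_fun b * ?g \<noteq> 0" using that(2) nz by simp
    then have "a \<noteq> 0" using that(1) by (metis const_fun_eq_0_iff mult_zero_left)
    then show ?thesis using that nz val_mult[of "const_fun a" ?f] val_mult[of "const_fun b" ?g]
      by (simp add: val_const)
  qed
  moreover have "l $ 2 \<noteq> 0 \<or> l $ 3 \<noteq> 0" using l(1) z by (auto simp: vec_eq_iff forall_3)
  ultimately show ?thesis using e by blast
qed

lemma mu_hat_le_madic:
  assumes "madic u v \<nu>"
  shows "mu_hat u v \<nu> \<le> beta0 u v \<nu>"
proof (rule mu_hat_le)
  fix h :: "'a poly poly" and d assume h: "h \<noteq> 0" "total_degree_le h d"
  obtain p where p: "coeff2 h p \<noteq> 0" using coeff2_nonzero[OF h(1)] by blast
  have "fst p + snd p \<le> d" using p h(2) by (auto simp: total_degree_le_coeff2)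
  then have "\<nu> (eval2 h u v) \<le> int d" using madic_val_le[OF assms p] by linarith
  then have "real_of_int (\<nu> (eval2 h u v)) \<le> real d * 1" by simp
  also have "\<dots> \<le> real d * real_of_int (beta0 u v \<nu>)"
    using beta0_pos by (intro mult_left_mono) auto
  finally show "\<nu> (eval2 h u v) \<le> real d * real_of_int (beta0 u v \<nu>)" .
qed

lemma mu_hat_le_tangent:
  fixes l :: "'a ^ 3"
  assumes nonmadic: "\<not> madic u v \<nu>" and l: "l \<noteq> 0" "beta0 u v \<nu> < \<nu> (line_equation u v l)"
  shows "mu_hat u v \<nu> \<le> beta0 u v \<nu> + (1 + real_of_int (delta0 u v \<nu>)) * tangent_value u v \<nu>"
proof -
  let ?l = "line_equation u v l"
  define t where "t = real_of_int (\<nu> ?l)"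
  define \<beta> where "\<beta> = real_of_int (beta0 u v \<nu>)"
  define V where "V = inverse (vol u v \<nu>)"
  have t: "tangent_value u v \<nu> = \<nu> ?l"
    unfolding tangent_value_def using nonmadic l tangent_value_unique by (auto intro!: the_equality)
  have pos: "0 < \<beta>" "\<beta> < t" using beta0_pos l(2) by (simp_all add: \<beta>_def t_def)
  define \<delta> where "\<delta> = real_of_int (delta0 u v \<nu>)"
  have \<delta>: "\<delta> = real_of_int (ceiling_plus ((V - 2 * \<beta> * t) / t\<^sup>2))"
    unfolding \<delta>_def delta0_def t V_def t_def \<beta>_def using nonmadic by simp
  have \<delta>0: "0 \<le> \<delta>" and \<delta>1: "(V - 2 * \<beta> * t) / t\<^sup>2 \<le> \<delta>"
    unfolding \<delta> ceiling_plus_def by auto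
  let ?B = "\<beta> + (1 + \<delta>) * t"
  \<comment> \<open>The truncation at 0 in \<open>ceiling_plus\<close> enters here: the bound must
    also cover curves containing the tangent line, which gain \<open>t\<close> per degree.\<close>
  have B1: "t \<le> ?B" using pos \<delta>0 by (simp add: algebra_simps)
  have "V - 2 * \<beta> * t \<le> \<delta> * t\<^sup>2" using \<delta>1 pos by (simp add: field_simps)
  \<comment> \<open>One of the two summands \<open>\<beta> * t\<close> from the definition of
    \<open>delta0\<close> is traded for \<open>t * t\<close>; this is the origin of the 1 in
    \<open>1 + \<delta>\<close>.\<close>
  moreover have "\<beta> * t \<le> t * t" using pos by (intro mult_right_mono) auto
  ultimately have B2: "V \<le> ?B * t" by (simp add: algebra_simps power2_eq_square)
  obtain a1 b1 a2 b2 L where L: "u = const_fun a1 * ?l + const_fun b1 * eval2 L u v"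
    "v = const_fun a2 * ?l + const_fun b2 * eval2 L u v" "degree_less L (Suc (Suc 0))" "coeff2 L (0, 0) = 0"
    using tangent_coordinate[OF l(1) tangent_line_through[OF l(2)]] .
  have "mu_hat u v \<nu> \<le> ?B"
  proof (rule mu_hat_le)
    fix h :: "'a poly poly" and d assume h: "h \<noteq> 0" "total_degree_le h d"
    have "?l \<in> \<O>" unfolding line_equation_eval2 by (rule eval2_local_ring)
    moreover have "0 < \<nu> ?l" using pos by (simp add: t_def)
    moreover have "\<nu> ?l \<le> ?B" using B1 by (simp add: t_def)
    moreover have "inverse (vol u v \<nu>) \<le> ?B * \<nu> ?l" using B2 by (simp add: t_def V_def)
    moreover have "degree_less h (Suc d)" using h by (simp add: total_degree_le_iff_less)
    ultimately show "\<nu> (eval2 h u v) \<le> real d * ?B"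
      using val_le_degree[OF _ line_equation_nonzero[OF l(1)] _ L(1,2) refl L(3,4) _ _ h(1)] by blast
  qed
  then show ?thesis by (simp add: \<beta>_def \<delta>_def t t_def)
qed

end

text \<open>After a single blowup the valuation is the multiplicity, hence m-adic. Otherwise the
  second point is a tangent direction at the first, and the line in that direction works because its
  strict transform passes through the second point.\<close>

lemma tangent_line_exists:
  fixes u v :: "'a::field plane_function_field"
  assumes good: "alg_indep u v" "field_gens u v" and \<nu>: "divisorial_valuation u v \<nu>" "\<not> madic u v \<nu>"
  shows "\<exists>l. l \<noteq> 0 \<and> beta0 u v \<nu> < \<nu> (line_equation u v l)"
proof -
  obtain C where "plane_valuation u v \<nu> C" using divisorial_plane_valuation[OF \<nu>(1) good] by blast
  then interpret plane_valuation u v \<nu> C .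
  obtain x y where xy: "blowup_coordinates u v x y"
    and ord: "\<And>f. f \<noteq> 0 \<Longrightarrow> \<nu> f = exceptional_order x y f"
    using \<nu>(1) unfolding divisorial_valuation_def by blast
  consider "x = u" "y = v" | c where "blowup_coordinates u (v / u - const_fun c) x y"
    | "blowup_coordinates (u / v) v x y"
    using blowup_coordinates_first[OF xy] by blast
  then show ?thesis
  proof cases
    case 1
    have "madic u v \<nu>"
    proof (rule madicI)
      fix h :: "'a poly poly" and q assume q: "coeff2 h q \<noteq> 0" "\<And>p. coeff2 h p \<noteq> 0 \<Longrightarrow> fst q + snd q \<le> fst p + snd p"
      have "eval2 h u v \<noteq> 0" using q(1) by auto
      then show "\<nu> (eval2 h u v) = int (fst q + snd q)"
        using ord exceptional_order_eval2[OF good q] 1 by simp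
    qed
    then show ?thesis using \<nu>(2) by simp
  next
    case (2 c)
    let ?y = "v / u - const_fun c"
    \<comment> \<open>Starting the sequence at the second point shows that \<nu> is centred there
      too, so \<open>?y\<close> has positive value; this is the excess over \<nu>(u) for the line v
      - c u.\<close>
    have "divisorial_valuation u ?y \<nu>"
      unfolding divisorial_valuation_def using 2 ord by blast
    then obtain C' where "plane_valuation u ?y \<nu> C'"
      using divisorial_plane_valuation alg_indep_translate[OF alg_indep_blowup_finite[OF good(1)]]
        field_gens_blowup(1)[OF good(2) uv_nonzero] by blast
    then interpret b: plane_valuation u ?y \<nu> C' .
    define l :: "'a ^ 3" where "l = vector [0, - c, 1]"
    have "line_equation u v l = u * ?y"
      unfolding line_equation_def l_def vector_3 using uv_nonzero
      by (simp add: const_fun.map_zero const_fun.map_one const_fun.map_uminus algebra_simps)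
    moreover have "\<nu> (u * ?y) = \<nu> u + \<nu> ?y"
      using uv_nonzero b.uv_nonzero by (intro val_mult)
    moreover have "beta0 u v \<nu> < \<nu> u + \<nu> ?y" using beta0_eq b.val_v_pos by linarith
    moreover have "l \<noteq> 0" by (auto simp: l_def vec_eq_iff forall_3 vector_3)
    ultimately show ?thesis by (intro exI[of _ l]) simp
  next
    case 3
    \<comment> \<open>At the point outside the first chart the same argument makes
      \<open>u / v\<close> positive, so \<nu>(u) exceeds \<nu>(v).\<close>
    have "divisorial_valuation (u / v) v \<nu>"
      unfolding divisorial_valuation_def using 3 ord by blast
    then obtain C' where "plane_valuation (u / v) v \<nu> C'"
      using divisorial_plane_valuation alg_indep_blowup_infinite[OF good(1)]
        field_gens_blowup(2)[OF good(2) uv_nonzero] by blast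
    then interpret b: plane_valuation "u / v" v \<nu> C' .
    define l :: "'a ^ 3" where "l = vector [0, 1, 0]"
    have "line_equation u v l = u"
      unfolding line_equation_def l_def vector_3 by (simp add: const_fun.map_zero const_fun.map_one)
    moreover have "beta0 u v \<nu> < \<nu> u"
      using beta0_eq b.val_u_pos val_divide[OF uv_nonzero] by linarith
    moreover have "l \<noteq> 0" by (auto simp: l_def vec_eq_iff forall_3 vector_3)
    ultimately show ?thesis by (intro exI[of _ l]) simp
  qed
qed

theorem corollary3p5:
  fixes p :: "'a::alg_closed_field ^ 3"
    and u v :: "'a plane_function_field"
    and \<nu> :: "'a plane_function_field \<Rightarrow> int"
  assumes "affine_coordinates_at p u v"
    and "divisorial_valuation u v \<nu>"
  shows "mu_hat u v \<nu> \<le>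
    real_of_int (beta0 u v \<nu>) + (1 + real_of_int (delta0 u v \<nu>)) * real_of_int (tangent_value u v \<nu>)"
proof -
  note good = affine_coordinates_good[OF assms(1)]
  obtain C where "plane_valuation u v \<nu> C"
    using divisorial_plane_valuation[OF assms(2) good] by blast
  then interpret plane_valuation u v \<nu> C .
  show ?thesis
  proof (cases "madic u v \<nu>")
    case True
    \<comment> \<open>Here \<open>delta0\<close> is -1, so the tangent term has coefficient
      0.\<close>
    then show ?thesis using mu_hat_le_madic by (simp add: delta0_def)
  next
    case False
    then show ?thesis
      using tangent_line_exists[OF good assms(2)] mu_hat_le_tangent by blast
  qed
qed

end
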